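(* Let $\mathcal E_1,\mathcal E_2$ be real Hilbert spaces, $\mathcal E=\mathcal E_1\times\mathcal E_2$ (with the product inner product), $b\in\mathcal E_2$, $Q\subset\mathcal E_2$, $K\subset\mathcal E_1$, and assume: (a) $f\colon\mathcal E_1\to\mathbb R$ is convex and differentiable with $\beta$-Lipschitz gradient for some $\beta>0$; (b) $Q$ is nonempty and $Q=Q_1+Q_2$, where $Q_1$ is a closed convex bounded set and $Q_2$ is a closed convex cone; (c) $K$ is nonempty, closed and convex; (d) $A\colon\mathcal E_1\to\mathcal E_2$ is linear and bounded; (e) there exists $\mu^0=(\mu^0_1,\mu^0_2)\in\mathrm{dom}(\partial f^* )\times Q$ such that $\mu_1^0+A^*\mu_2^0\in\mathrm{dom}(\sigma_{-K})$; (f) there exists a compact set $K^{-1}\subset K$ such that $-b\in\mathrm{int}\big(Q_2^\ominus-A\,\overline{\mathrm{conv}}(K^{-1})\big)$, where $Q_2^\ominus=\{x_2\in\mathcal E_2: \langle\mu_2,x_2\rangle\le 0\ \ \forall\mu_2\in Q_2\}$. Let $V$ be the value (infimum) of the problem $\min_{x_1\in\mathcal E_1} f(x_1)+\sigma_Q(Ax_1-b)+\iota_K(x_1)$, and let $E=\{x\in\mathcal E: x_1\in -K,\ x_2=Ax_1\}$. Consider sequences generated by the Dualized Level-Set method described in the context, and assume moreover that (g) for all $t\in\mathbb N$, $\partial\sigma_E(\mu^t)\neq\varnothing$, and there is a constant $C_{\mathrm{oracle}}$ such that for all $t\in\mathbb N$ the vector $v^t=(v_1^t,Av_1^t)$ satisfies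 $\|v^t\|\le C_{\mathrm{oracle}}$. Then the primal-dual gap $\Delta^t$ converges to $0$ with a speed of order $1/\sqrt t$, i.e. there is $C>0$ such that $\Delta^t\le C/\sqrt t$ for all $t\ge1$. Also, for all $t\in\mathbb N$, $\hat x_2^t=A\hat x_1^t$, and the same convergence speed (a bound of the form $C/\sqrt t$ for all $t\geq 1$) holds for $$f(\hat x_1^t)+\sigma_Q(A\hat x_1^t-b)-V\quad\text{and for}\quad f^*(\hat\mu_1^t)+\iota_Q(\hat\mu_2^t)+\langle\hat\mu_2^t,b\rangle+\sigma_E(\hat\mu^t)+V .$$
   Context: Notation. Elements of $\mathcal E=\mathcal E_1\times\mathcal E_2$ are written $\mu=(\mu_1,\mu_2)$, $x=(x_1,x_2)$. $f^*$ is the Legendre–Fenchel conjugate, $\partial$ the convex subdifferential, $\mathrm{dom}(\partial g)=\{\partial g\ne\varnothing\}$, $\mathrm{dom}(g)$ the set where $g$ is finite, $\sigma_S(\mu)=\sup_{x\in S}\langle\mu,x\rangle$ the support function, $\iota_S$ the function equal to $0$ on $S$ and $+\infty$ elsewhere, $\mathrm{proj}_Q$ the metric projection, $d(\cdot,Q)$ the distance to $Q$. $\mathcal M(S)$ is the space of signed Radon measures on $S$, $\mathcal M^+(S)$ the subset of nonnegative ones. For a compact $S\subset\mathcal E_1$ and $m\in\mathcal M(S)$, $\mathfrak E m\in\mathcal E_1$ is the unique vector with $\langle\mu,\mathfrak E m\rangle=\int_S\langle\mu,v\rangle\,dm(v)$ for all $\mu\in\mathcal E_1$. $\tilde f$ is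 the perspective function; for $s>0$, $\tilde f(x,s)=s f(x/s)$ (only $s\ge1$ occurs below). A set is called simple if it is of the form $K^{-1}\cup S$ with $S$ finite. Dualized Level-Set (DLS) method. Input: $\mu^0$ and $K^{-1}$ as in hypotheses (e) and (f), $w_1^0\in\partial f^*(\mu^0_1)$, $\lambda\in(0,1)$. Set $\bar h^{-1}=+\infty$, $\hat\mu^{-1}=\mu^0$, $\bar\Delta=+\infty$. For $t=0,1,2,\dots$: 1. Oracle: choose $v_1^t\in-\mathrm{argmin}_{u\in K}\langle\mu_1^t+A^*\mu_2^t,u\rangle$ and set $\tilde K^t=\overline{\mathrm{conv}}(K^{t-1}\cup\{-v_1^t\})$. 2. Dual update: $\bar h^t=\min\{\bar h^{t-1},\ \langle\mu_2^t,b\rangle+\langle\mu_1^t,w_1^t\rangle+\langle\mu_1^t+A^*\mu_2^t,v_1^t\rangle-f(w_1^t)\}$. If $\bar h^t<\bar h^{t-1}$ set $\hat\mu^t=\mu^t$, otherwise $\hat\mu^t=\hat\mu^{t-1}$. 3. Primal update: let $\hat x^t=(\hat x_1^t,\hat x_2^t)$ be a minimizer of $f(x_1)+\sigma_Q(x_2-b)$ over $\{x\in\mathcal E: x_1\in\tilde K^t,\ x_2=Ax_1\}$ (equivalently, $\hat x_1^t$ minimizes $f(x_1)+\sigma_Q(Ax_1-b)$ over $\tilde K^t$). Set $\underline h^t=-f(\hat x_1^t)-\sigma_Q(A\hat x_1^t-b)$, $\Delta^t=\bar h^t-\underline h^t$, $\ell^t=\lambda\bar h^t+(1-\lambda)\underline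 h^t$. 4. Pruning: if $\Delta^t<(1-\lambda)\bar\Delta$, take any simple $K^t\subset\overline{\mathrm{conv}}(K^{t-1}\cup\{-v_1^t\})$ with $\hat x_1^t\in\overline{\mathrm{conv}}(K^t)$, and set $\bar\Delta=\Delta^t$; otherwise set $K^t=K^{t-1}\cup\{-v_1^t\}$. 5. Dual candidate: take $m^t$ a solution of $$\min_{m\in-\mathcal M^+(K^t)}\ \tilde f\big(-\mathfrak Em+w_1^t,\,1-m(K^t)\big)+\tfrac12\big(\|\tilde\mu_2\|^2-d(\tilde\mu_2,Q)^2\big)-\ell^t m(K^t),\qquad \tilde\mu_2=-A\,\mathfrak Em+m(K^t)b+\mu_2^t,$$ and set $w_1^{t+1}=\dfrac{w_1^t-\mathfrak Em^t}{1-m^t(K^t)}$, $\mu_1^{t+1}=\nabla f(w_1^{t+1})$, $\mu_2^{t+1}=\mathrm{proj}_Q\big(\mu_2^t+m^t(K^t)b-A\,\mathfrak Em^t\big)$, $\mu^{t+1}=(\mu_1^{t+1},\mu_2^{t+1})$. *)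

theory Defs
  imports "HOL-Analysis.Analysis"
begin

text \<open>
  Functions that may take infinite values are \<^typ>\<open>ereal\<close>-valued. The suprema below are
  taken in \<^typ>\<open>ereal\<close>, so a supremum over the empty set is \<open>-\<infinity>\<close>.
\<close>

definition conjugate :: "('a::real_inner \<Rightarrow> real) \<Rightarrow> 'a \<Rightarrow> ereal" where
  "conjugate f \<mu> = (SUP x. ereal (\<mu> \<bullet> x - f x))"

definition support_fun :: "'a::real_inner set \<Rightarrow> 'a \<Rightarrow> ereal" where
  "support_fun S \<mu> = (SUP x\<in>S. ereal (\<mu> \<bullet> x))"

definition indicator_fun :: "'a set \<Rightarrow> 'a \<Rightarrow> ereal" where
  "indicator_fun S x = (if x \<in> S then 0 else \<infinity>)"

definition eff_dom :: "('a \<Rightarrow> ereal) \<Rightarrow> 'a set" where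
  "eff_dom g = {x. \<bar>g x\<bar> \<noteq> \<infinity>}"

definition subdiff :: "('a::real_inner \<Rightarrow> ereal) \<Rightarrow> 'a \<Rightarrow> 'a set" where
  "subdiff g x = {s. x \<in> eff_dom g \<and> (\<forall>y. g y \<ge> g x + ereal (s \<bullet> (y - x)))}"

definition dom_subdiff :: "('a::real_inner \<Rightarrow> ereal) \<Rightarrow> 'a set" where
  "dom_subdiff g = {x. subdiff g x \<noteq> {}}"

definition polar_cone :: "'a::real_inner set \<Rightarrow> 'a set" where
  "polar_cone S = {x. \<forall>\<mu>\<in>S. \<mu> \<bullet> x \<le> 0}"

definition closed_hull :: "'a::real_normed_vector set \<Rightarrow> 'a set" where
  "closed_hull S = closure (convex hull S)"

text \<open>The library's \<^const>\<open>closest_point\<close> is restricted to Heine--Borel spaces, which excludes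
  infinite-dimensional Hilbert spaces.\<close>

definition metric_proj :: "'a::metric_space set \<Rightarrow> 'a \<Rightarrow> 'a" where
  "metric_proj Q x = (THE y. y \<in> Q \<and> dist x y = infdist x Q)"

text \<open>The perspective function is only meant for \<open>s > 0\<close>; all arguments \<open>s\<close>
  occurring below satisfy \<open>s \<ge> 1\<close>.\<close>

definition perspective :: "('a::real_vector \<Rightarrow> real) \<Rightarrow> 'a \<Rightarrow> real \<Rightarrow> real" where
  "perspective f x s = s * f (x /\<^sub>R s)"

text \<open>
  Nonnegative Radon measures on a compact set \<open>S\<close>: finite Borel measures on the subspace \<open>S\<close>
  (so \<^term>\<open>space \<nu> = S\<close>) that are inner regular with respect to compact sets. The library has
  no signed measures; a measure \<open>m\<close> in \<open>- M\<^sup>+(S)\<close> is represented by the nonnegative measure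
  \<open>\<nu> = - m\<close>, and \<open>neg_mass S \<nu>\<close>, \<open>neg_moment \<nu>\<close> stand for \<open>m(S)\<close> and for the vector
  representing \<open>\<mu> \<mapsto> \<integral>\<^sub>S \<langle>\<mu>, v\<rangle> dm(v)\<close>.
\<close>

definition radon_measures :: "'a::metric_space set \<Rightarrow> 'a measure set" where
  "radon_measures S = {\<nu>. sets \<nu> = sets (restrict_space borel S) \<and> finite_measure \<nu> \<and>
     (\<forall>B\<in>sets \<nu>. emeasure \<nu> B = (SUP C\<in>{C. C \<subseteq> B \<and> compact C}. emeasure \<nu> C))}"

definition neg_mass :: "'a set \<Rightarrow> 'a measure \<Rightarrow> real" where
  "neg_mass S \<nu> = - measure \<nu> S"

definition neg_moment :: "'a::real_inner measure \<Rightarrow> 'a" where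
  "neg_moment \<nu> = (THE e. \<forall>\<mu>. \<mu> \<bullet> e = - (LINT v|\<nu>. \<mu> \<bullet> v))"

definition simple_set :: "'a set \<Rightarrow> 'a set \<Rightarrow> bool" where
  "simple_set Kinit S \<longleftrightarrow> (\<exists>F. finite F \<and> S = Kinit \<union> F)"

text \<open>\<open>prev x X t\<close> is \<open>X\<close> at index \<open>t - 1\<close>, where \<open>x\<close> is the value of \<open>X\<close> at index \<open>-1\<close>.\<close>

definition prev :: "'x \<Rightarrow> (nat \<Rightarrow> 'x) \<Rightarrow> nat \<Rightarrow> 'x" where
  "prev x X t = (case t of 0 \<Rightarrow> x | Suc s \<Rightarrow> X s)"

text \<open>Objective of the dual candidate problem, as a function of \<open>\<nu> = - m\<close> in
  \<^term>\<open>radon_measures S\<close>.\<close>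

definition candidate_obj ::
  "('a::real_inner \<Rightarrow> real) \<Rightarrow> ('a \<Rightarrow> 'b::real_inner) \<Rightarrow> 'b \<Rightarrow> 'b set \<Rightarrow> 'a \<Rightarrow> 'b \<Rightarrow> ereal \<Rightarrow>
   'a set \<Rightarrow> 'a measure \<Rightarrow> ereal" where
  "candidate_obj f A b Q w \<mu>2 lev S \<nu> =
    (let e = neg_moment \<nu>; s = neg_mass S \<nu>; \<mu>t = - A e + s *\<^sub>R b + \<mu>2
     in ereal (perspective f (- e + w) (1 - s) + 1/2 * ((norm \<mu>t)\<^sup>2 - (infdist \<mu>t Q)\<^sup>2))
        - lev * ereal s)"

text \<open>
  The sequences \<open>\<mu>, w, v, hbar, \<mu>hat, xhat, hlow, \<Delta>, lev, Dbar, Ks, \<nu>\<close> are generated by the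
  Dualized Level-Set method. Index \<open>t\<close> is the superscript \<open>t\<close>; the values at index \<open>-1\<close>
  are \<open>\<infinity>\<close> for \<open>hbar\<close>, \<open>\<mu>0\<close> for \<open>\<mu>hat\<close>, and \<open>Kinit\<close> for \<open>Ks\<close>. The mutable
  threshold is recorded as \<open>Dbar t\<close>, its value after iteration \<open>t\<close>, with initial value
  \<open>\<infinity>\<close>. \<open>gradf\<close> is the gradient of \<open>f\<close>, and \<open>\<nu> t\<close> is the negative of the measure
  chosen at iteration \<open>t\<close>.
\<close>

definition dls_method ::
  "('a::{real_inner,complete_space} \<Rightarrow> real) \<Rightarrow> ('a \<Rightarrow> 'a) \<Rightarrow>
   ('a \<Rightarrow> 'b::{real_inner,complete_space}) \<Rightarrow> 'b \<Rightarrow> 'b set \<Rightarrow> 'a set \<Rightarrow> 'a set \<Rightarrow> 'a \<times> 'b \<Rightarrow> real \<Rightarrow>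
   (nat \<Rightarrow> 'a \<times> 'b) \<Rightarrow> (nat \<Rightarrow> 'a) \<Rightarrow> (nat \<Rightarrow> 'a) \<Rightarrow> (nat \<Rightarrow> ereal) \<Rightarrow> (nat \<Rightarrow> 'a \<times> 'b) \<Rightarrow>
   (nat \<Rightarrow> 'a \<times> 'b) \<Rightarrow> (nat \<Rightarrow> ereal) \<Rightarrow> (nat \<Rightarrow> ereal) \<Rightarrow> (nat \<Rightarrow> ereal) \<Rightarrow> (nat \<Rightarrow> ereal) \<Rightarrow>
   (nat \<Rightarrow> 'a set) \<Rightarrow> (nat \<Rightarrow> 'a measure) \<Rightarrow> bool" where
  "dls_method f gradf A b Q K Kinit \<mu>0 lam \<mu> w v hbar \<mu>hat xhat hlow \<Delta> lev Dbar Ks \<nu> \<longleftrightarrow>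
     \<mu> 0 = \<mu>0 \<and> w 0 \<in> subdiff (conjugate f) (fst \<mu>0) \<and>
     (\<forall>t. let Kt = closed_hull (prev Kinit Ks t \<union> {- v t});
              \<mu>1 = fst (\<mu> t); \<mu>2 = snd (\<mu> t); x1 = fst (xhat t);
              e = neg_moment (\<nu> t); s = neg_mass (Ks t) (\<nu> t)
          in
       is_arg_min (\<lambda>u. (\<mu>1 + adjoint A \<mu>2) \<bullet> u) (\<lambda>u. u \<in> K) (- v t) \<and>
       hbar t = min (prev \<infinity> hbar t)
         (ereal (\<mu>2 \<bullet> b + \<mu>1 \<bullet> w t + (\<mu>1 + adjoint A \<mu>2) \<bullet> v t - f (w t))) \<and>
       \<mu>hat t = (if hbar t < prev \<infinity> hbar t then \<mu> t else prev \<mu>0 \<mu>hat t) \<and>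
       is_arg_min (\<lambda>x. ereal (f (fst x)) + support_fun Q (snd x - b))
         (\<lambda>x. fst x \<in> Kt \<and> snd x = A (fst x)) (xhat t) \<and>
       hlow t = - ereal (f x1) - support_fun Q (A x1 - b) \<and>
       \<Delta> t = hbar t - hlow t \<and>
       lev t = ereal lam * hbar t + ereal (1 - lam) * hlow t \<and>
       (if \<Delta> t < ereal (1 - lam) * prev \<infinity> Dbar t
        then simple_set Kinit (Ks t) \<and> Ks t \<subseteq> Kt \<and> x1 \<in> closed_hull (Ks t) \<and> Dbar t = \<Delta> t
        else Ks t = prev Kinit Ks t \<union> {- v t} \<and> Dbar t = prev \<infinity> Dbar t) \<and>
       is_arg_min (candidate_obj f A b Q (w t) \<mu>2 (lev t) (Ks t))
         (\<lambda>m. m \<in> radon_measures (Ks t)) (\<nu> t) \<and>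
       w (Suc t) = (w t - e) /\<^sub>R (1 - s) \<and>
       \<mu> (Suc t) = (gradf (w (Suc t)), metric_proj Q (\<mu>2 + s *\<^sub>R b - A e)))"

end

theory Submission
  imports Defs
begin

text \<open>
  The dual candidate \<open>\<mu>\<^sup>t\<^sup>+\<^sup>1\<close> is the Bregman projection of \<open>\<mu>\<^sup>t\<close>, for the distance generated by
  \<open>f\<^sup>* + \<parallel>\<cdot>\<parallel>\<^sup>2/2\<close>, onto the set of \<open>\<mu> \<in> \<E>\<^sub>1 \<times> Q\<close> at which the cutting-plane model of the dual
  objective given by \<open>K\<^sup>t\<close> is at most \<open>\<ell>\<^sup>t\<close>; the measure \<open>- m\<^sup>t\<close> is the multiplier of that constraint.
  Between two prunings the models increase, and since the gap stays above \<open>1 - \<lambda>\<close> times its value at the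
  last pruning, all level sets of the phase contain an (approximate) minimiser of the last model, which
  exists by strong duality. Hence the squared steps of a phase have bounded sum. The oracle cut forces
  a decrease \<open>(1 - \<lambda>)\<Delta>\<^sup>t\<close> of the linearisation in one step, so a step has length at least a constant times
  \<open>\<Delta>\<^sup>t\<close>, and a phase with initial gap \<open>\<delta>\<close> has \<open>O(\<delta>\<^sup>-\<^sup>2)\<close> steps. The initial gaps decay geometrically
  from phase to phase, so the last phase dominates. The constants are uniform because \<open>w\<^sup>t\<close> is a convex
  combination of \<open>w\<^sup>0\<close> and points of the closed hull of the cuts, and \<open>\<mu>\<^sub>2\<^sup>t\<close> is bounded on level sets by the
  Slater-type condition on \<open>- b\<close>.
\<close>

section \<open>Projections and duality in Hilbert spaces\<close>

text \<open>Takes the place of weak compactness. Almost nearest points \<open>y n\<close> of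
  \<open>C n\<close> form a Cauchy sequence by the parallelogram law, because the distances
  \<open>infdist x (C n)\<close> increase, are bounded by \<open>R\<close> and hence
  converge.\<close>

lemma nested_convex_closest:
  fixes C :: "nat \<Rightarrow> 'a::{real_inner,complete_space} set"
  assumes closed: "\<And>n. closed (C n)" and convex: "\<And>n. convex (C n)"
    and ne: "\<And>n. C n \<noteq> {}" and dec: "decseq C" and bd: "\<And>n. infdist x (C n) \<le> R"
  obtains y where "\<And>n. y \<in> C n" "dist x y \<le> R"
proof -
  define r where "r n = infdist x (C n)" for n
  have rn: "0 \<le> r n" for n by (simp add: r_def infdist_nonneg)
  have inc: "incseq r"
    unfolding r_def incseq_def using dec ne by (auto intro!: infdist_mono simp: decseq_def)
  obtain l where l: "r \<longlonglongrightarrow> l" "\<And>n. r n \<le> l"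
    using incseq_convergent[OF inc, of R] bd by (auto simp: r_def)
  have lR: "l \<le> R" using LIMSEQ_le_const2[OF l(1)] bd by (auto simp: r_def)
  have "\<exists>y\<in>C n. dist x y < r n + 1 / real (Suc n)" for n
  proof -
    have "(INF a\<in>C n. dist x a) < r n + 1 / real (Suc n)"
      using ne by (simp add: r_def infdist_notempty)
    then show ?thesis using cInf_lessD[of "dist x ` C n"] ne by blast
  qed
  then obtain y where y: "\<And>n. y n \<in> C n" "\<And>n. dist x (y n) < r n + 1 / real (Suc n)" by metis
  define s where "s n = (r n + 1 / real (Suc n))\<^sup>2" for n
  have "(\<lambda>n. r n + 1 / real (Suc n)) \<longlonglongrightarrow> l + 0"
    by (intro tendsto_add l(1) LIMSEQ_Suc lim_1_over_n)
  then have rl: "(\<lambda>n. r n + 1 / real (Suc n)) \<longlonglongrightarrow> l" by simp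
  then have sl: "s \<longlonglongrightarrow> l\<^sup>2" unfolding s_def by (intro tendsto_power)
  have r2l: "(\<lambda>n. (r n)\<^sup>2) \<longlonglongrightarrow> l\<^sup>2" using l(1) by (intro tendsto_power)
  \<comment> \<open>The midpoint of \<open>y n\<close> and \<open>y m\<close> lies in the larger set
    \<open>C n\<close>, so its distance to \<open>x\<close> is at least \<open>r n\<close>; the
    parallelogram identity then bounds \<open>dist (y m) (y n)\<close>.\<close>
  have key: "(dist (y m) (y n))\<^sup>2 \<le> 2 * s n + 2 * s m - 4 * (r n)\<^sup>2" if "n \<le> m" for m n
  proof -
    have ym: "y m \<in> C n" using y(1)[of m] decseqD[OF dec that] by auto
    have "(1/2) *\<^sub>R y n + (1/2) *\<^sub>R y m \<in> C n"
      using convexD[OF convex y(1)[of n] ym, of "1/2" "1/2"] by simp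
    then have "2 * r n \<le> 2 * dist x ((1/2) *\<^sub>R y n + (1/2) *\<^sub>R y m)"
      by (simp add: r_def infdist_le)
    also have "\<dots> = norm (y n - x + (y m - x))"
    proof -
      have "2 *\<^sub>R (x - ((1/2) *\<^sub>R y n + (1/2) *\<^sub>R y m)) = - (y n - x + (y m - x))"
        by (simp add: scaleR_right_diff_distrib scaleR_right_distrib scaleR_2)
      then show ?thesis
        by (metis dist_norm norm_minus_cancel norm_scaleR abs_numeral)
    qed
    finally have "(2 * r n)\<^sup>2 \<le> (norm (y n - x + (y m - x)))\<^sup>2"
      using rn[of n] by (intro power_mono) auto
    moreover have "(norm (y n - x + (y m - x)))\<^sup>2 + (dist (y m) (y n))\<^sup>2
        = 2 * (norm (y n - x))\<^sup>2 + 2 * (norm (y m - x))\<^sup>2"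
      by (simp add: dist_norm power2_norm_eq_inner algebra_simps inner_commute)
    moreover have "(norm (y k - x))\<^sup>2 \<le> s k" for k
      unfolding s_def using y(2)[of k] by (intro power_mono) (auto simp: dist_norm norm_minus_commute)
    from this[of n] this[of m] have "2 * (norm (y n - x))\<^sup>2 + 2 * (norm (y m - x))\<^sup>2 \<le> 2 * s n + 2 * s m"
      by simp
    ultimately show ?thesis by (simp add: power_mult_distrib)
  qed
  have "Cauchy y"
  proof (rule metric_CauchyI)
    fix e :: real assume "e > 0"
    then have e: "e\<^sup>2 / 8 > 0" by simp
    have "\<forall>\<^sub>F n in sequentially. dist (s n) (l\<^sup>2) < e\<^sup>2 / 8 \<and> dist ((r n)\<^sup>2) (l\<^sup>2) < e\<^sup>2 / 8"
      using tendstoD[OF sl e] tendstoD[OF r2l e] by (rule eventually_conj)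
    then obtain N where N: "\<And>n. n \<ge> N \<Longrightarrow> dist (s n) (l\<^sup>2) < e\<^sup>2 / 8 \<and> dist ((r n)\<^sup>2) (l\<^sup>2) < e\<^sup>2 / 8"
      by (auto simp: eventually_sequentially)
    have lt: "dist (y m) (y n) < e" if "n \<ge> N" "n \<le> m" for m n
    proof -
      have "\<bar>s n - l\<^sup>2\<bar> < e\<^sup>2 / 8" "\<bar>s m - l\<^sup>2\<bar> < e\<^sup>2 / 8" "\<bar>(r n)\<^sup>2 - l\<^sup>2\<bar> < e\<^sup>2 / 8"
        using N[of n] N[of m] that by (simp_all add: dist_real_def)
      then have "(dist (y m) (y n))\<^sup>2 < e\<^sup>2"
        using key[OF that(2)] by linarith
      then show ?thesis using \<open>e > 0\<close> by (simp add: power_less_imp_less_base)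
    qed
    have "dist (y m) (y n) < e" if "m \<ge> N" "n \<ge> N" for m n
      using lt[of m n] lt[of n m] that by (cases "m \<le> n") (auto simp: dist_commute)
    then show "\<exists>M. \<forall>m\<ge>M. \<forall>n\<ge>M. dist (y m) (y n) < e" by blast
  qed
  then obtain z where z: "y \<longlonglongrightarrow> z" using Cauchy_convergent convergent_def by blast
  have "z \<in> C n" for n
  proof (rule closed_sequentially[OF closed])
    show "(\<lambda>k. y (k + n)) \<longlonglongrightarrow> z" using z by (rule LIMSEQ_ignore_initial_segment)
    show "y (k + n) \<in> C n" for k
      using y(1)[of "k + n"] decseqD[OF dec, of n "k + n"] by auto
  qed
  moreover have "dist x z \<le> l"
  proof (rule LIMSEQ_le)
    show "(\<lambda>n. dist x (y n)) \<longlonglongrightarrow> dist x z" using z by (intro tendsto_intros)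
    show "\<exists>N. \<forall>n\<ge>N. dist x (y n) \<le> r n + 1 / real (Suc n)" using y(2) less_imp_le by blast
  qed (fact rl)
  ultimately show ?thesis using lR that by force
qed

lemma nested_convex_Inter_nonempty:
  fixes C :: "nat \<Rightarrow> 'a::{real_inner,complete_space} set"
  assumes closed: "\<And>n. closed (C n)" and convex: "\<And>n. convex (C n)"
    and ne: "\<And>n. C n \<noteq> {}" and dec: "decseq C" and bd: "bounded (C 0)"
  obtains y where "\<And>n. y \<in> C n"
proof -
  obtain R where R: "\<And>y. y \<in> C 0 \<Longrightarrow> dist 0 y \<le> R" using bd by (auto simp: bounded_any_center[of _ 0])
  have "infdist 0 (C n) \<le> R" for n
  proof -
    obtain y where "y \<in> C n" using ne by blast
    moreover then have "y \<in> C 0" using decseqD[OF dec, of 0 n] by auto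
    ultimately show ?thesis using R infdist_le2 by blast
  qed
  then show ?thesis using nested_convex_closest[OF closed convex ne dec] that by metis
qed

section \<open>Metric projections onto closed convex sets\<close>

lemma exists_nearest_point:
  fixes S :: "'a::{real_inner,complete_space} set"
  assumes "closed S" "convex S" "S \<noteq> {}"
  obtains y where "y \<in> S" "dist x y = infdist x S"
  using nested_convex_closest[of "\<lambda>_. S" x "infdist x S"] assms
  by (metis decseq_const infdist_le order_antisym order_refl)

text \<open>A positive inner product would let a short move from \<open>y\<close> towards
  \<open>z\<close> come closer to \<open>x\<close>; conversely, expand the square of
  \<open>norm (x - z)\<close> around \<open>y\<close>.\<close>

lemma nearest_point_iff:
  fixes S :: "'a::real_inner set"
  assumes "convex S" "y \<in> S"
  shows "dist x y = infdist x S \<longleftrightarrow> (\<forall>z\<in>S. (x - y) \<bullet> (z - y) \<le> 0)"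
proof
  assume eq: "dist x y = infdist x S"
  show "\<forall>z\<in>S. (x - y) \<bullet> (z - y) \<le> 0"
  proof
    fix z assume z: "z \<in> S"
    show "(x - y) \<bullet> (z - y) \<le> 0"
    proof (rule ccontr)
      assume "\<not> ?thesis"
      then obtain u where u: "u > 0" "u \<le> 1" "dist (y + u *\<^sub>R (z - y)) x < dist y x"
        using closer_point_lemma[of x y z] by force
      have "y + u *\<^sub>R (z - y) \<in> S"
        using convexD_alt[OF assms(1) assms(2) z, of u] u by (simp add: algebra_simps)
      then show False using infdist_le[of "y + u *\<^sub>R (z - y)" S x] u eq by (simp add: dist_commute)
    qed
  qed
next
  assume le: "\<forall>z\<in>S. (x - y) \<bullet> (z - y) \<le> 0"
  have "dist x y \<le> dist x z" if "z \<in> S" for z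
  proof -
    have "(norm (x - z))\<^sup>2 = (norm (x - y))\<^sup>2 - 2 * ((x - y) \<bullet> (z - y)) + (norm (z - y))\<^sup>2"
      by (simp add: power2_norm_eq_inner algebra_simps inner_commute)
    then have "(norm (x - y))\<^sup>2 \<le> (norm (x - z))\<^sup>2"
      using le[rule_format, OF that] by (smt (verit) zero_le_power2)
    then show ?thesis unfolding dist_norm by (rule power2_le_imp_le) simp
  qed
  moreover have "S \<noteq> {}" using assms(2) by blast
  ultimately have "dist x y \<le> infdist x S"
    by (simp add: infdist_notempty cINF_greatest)
  then show "dist x y = infdist x S" using infdist_le[OF assms(2), of x] by simp
qed

lemma metric_proj_nearest:
  fixes S :: "'a::{real_inner,complete_space} set"
  assumes "closed S" "convex S" "S \<noteq> {}"
  shows "metric_proj S x \<in> S \<and> dist x (metric_proj S x) = infdist x S"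
proof -
  obtain y where y: "y \<in> S" "dist x y = infdist x S" using exists_nearest_point[OF assms] .
  have "z = y" if "z \<in> S" "dist x z = infdist x S" for z
  proof -
    have "(x - y) \<bullet> (z - y) \<le> 0" "(x - z) \<bullet> (y - z) \<le> 0"
      using nearest_point_iff[OF assms(2)] y that by blast+
    moreover have "(norm (z - y))\<^sup>2 = (x - y) \<bullet> (z - y) + (x - z) \<bullet> (y - z)"
      by (simp add: power2_norm_eq_inner algebra_simps inner_commute)
    ultimately have "(norm (z - y))\<^sup>2 \<le> 0" by linarith
    then show ?thesis by simp
  qed
  then have "(THE y. y \<in> S \<and> dist x y = infdist x S) = y" using y by blast
  then show ?thesis using y by (simp add: metric_proj_def)
qed

lemmas metric_proj_in = metric_proj_nearest[THEN conjunct1]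
  and metric_proj_dist = metric_proj_nearest[THEN conjunct2]

lemma metric_proj_obtuse:
  fixes S :: "'a::{real_inner,complete_space} set"
  assumes "closed S" "convex S" "z \<in> S"
  shows "(x - metric_proj S x) \<bullet> (z - metric_proj S x) \<le> 0"
proof -
  have "S \<noteq> {}" using assms(3) by blast
  from metric_proj_nearest[OF assms(1,2) this, of x] show ?thesis
    using nearest_point_iff[OF assms(2)] assms(3) by blast
qed

lemma metric_proj_nonexpansive:
  fixes S :: "'a::{real_inner,complete_space} set"
  assumes "closed S" "convex S" "S \<noteq> {}"
  shows "norm (metric_proj S x - metric_proj S y) \<le> norm (x - y)"
proof -
  let ?p = "metric_proj S x" and ?q = "metric_proj S y"
  have "(x - ?p) \<bullet> (?q - ?p) \<le> 0" "(y - ?q) \<bullet> (?p - ?q) \<le> 0"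
    using metric_proj_obtuse[OF assms(1,2)] metric_proj_in[OF assms] by blast+
  moreover have "(norm (?p - ?q))\<^sup>2 = (x - ?p) \<bullet> (?q - ?p) + (y - ?q) \<bullet> (?p - ?q) + (x - y) \<bullet> (?p - ?q)"
    by (simp add: power2_norm_eq_inner algebra_simps inner_commute)
  ultimately have "(norm (?p - ?q))\<^sup>2 \<le> norm (x - y) * norm (?p - ?q)"
    using norm_cauchy_schwarz[of "x - y" "?p - ?q"] by linarith
  then show ?thesis
    by (metis mult_le_cancel_right norm_ge_zero order_antisym_conv power2_eq_square linorder_not_le norm_le_zero_iff)
qed

section \<open>Riesz representation and the adjoint\<close>

lemma riesz_representation:
  fixes \<phi> :: "'a::{real_inner,complete_space} \<Rightarrow> real"
  assumes "bounded_linear \<phi>"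
  obtains e where "\<And>x. \<phi> x = x \<bullet> e"
proof (cases "\<forall>x. \<phi> x = 0")
  case True then show ?thesis using that[of 0] by simp
next
  case False
  interpret bounded_linear \<phi> by fact
  define H where "H = {x. \<phi> x = 1}"
  obtain x0 where "\<phi> x0 \<noteq> 0" using False by blast
  then have "x0 /\<^sub>R \<phi> x0 \<in> H" by (simp add: H_def scaleR)
  moreover have "closed H" unfolding H_def
    by (intro closed_Collect_eq linear_continuous_on assms continuous_on_const)
  moreover have "convex H"
    unfolding H_def convex_def by (auto simp: add scaleR)
  ultimately have H: "closed H" "convex H" "H \<noteq> {}" by blast+
  \<comment> \<open>The point of the hyperplane \<open>H\<close> nearest to 0 is orthogonal to the
    kernel of \<open>\<phi>\<close>, so a multiple of it represents \<open>\<phi>\<close>.\<close>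
  define y where "y = metric_proj H 0"
  have yH: "y \<in> H" using metric_proj_in[OF H] by (simp add: y_def)
  then have y1: "\<phi> y = 1" by (simp add: H_def)
  then have y0: "y \<noteq> 0" using zero by force
  have ker: "k \<bullet> y = 0" if "\<phi> k = 0" for k
  proof -
    have "y + k \<in> H" "y - k \<in> H" using y1 that by (auto simp: H_def add diff)
    then have "(0 - y) \<bullet> (y + k - y) \<le> 0" "(0 - y) \<bullet> (y - k - y) \<le> 0"
      unfolding y_def using metric_proj_obtuse[OF H(1,2)] by blast+
    then show ?thesis by (simp add: inner_commute)
  qed
  have "\<phi> x = x \<bullet> (y /\<^sub>R (y \<bullet> y))" for x
  proof -
    have "(x - \<phi> x *\<^sub>R y) \<bullet> y = 0" by (rule ker) (simp add: diff scaleR y1)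
    then show ?thesis using y0 by (simp add: inner_diff_left field_simps)
  qed
  then show ?thesis by (rule that)
qed

text \<open>\<open>adjoint\<close> is a Hilbert choice; Riesz representation shows that some map has
  the defining property, so the chosen one has it.\<close>

lemma adjoint_inner:
  fixes A :: "'a::{real_inner,complete_space} \<Rightarrow> 'b::real_inner"
  assumes "bounded_linear A"
  shows "adjoint A y \<bullet> x = y \<bullet> A x"
proof -
  have "\<exists>e. \<forall>x. A x \<bullet> y = x \<bullet> e" for y
    using riesz_representation[of "\<lambda>x. A x \<bullet> y"] bounded_linear_compose[OF bounded_linear_inner_left assms]
    by (metis comp_apply)
  then obtain h where "\<forall>x y. A x \<bullet> y = x \<bullet> h y" by metis
  then have "\<forall>x y. A x \<bullet> y = x \<bullet> adjoint A y"
    unfolding adjoint_def by (rule someI[where P = "\<lambda>h. \<forall>x y. A x \<bullet> y = x \<bullet> h y"])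
  then show ?thesis by (metis inner_commute)
qed

text \<open>For \<open>z\<close> in the closure, the points of \<open>S\<close> having a partner in
  \<open>T\<close> with sum within \<open>1 / real (Suc n)\<close> of \<open>z\<close> form nonempty
  convex sets. Their closures decrease inside the bounded set \<open>S\<close>, so they share a
  point \<open>x\<close>, and then \<open>z - x\<close> lies in \<open>T\<close>.\<close>

lemma closed_convex_bounded_sum:
  fixes S T :: "'a::{real_inner,complete_space} set"
  assumes S: "closed S" "convex S" "bounded S" and T: "closed T" "convex T"
  shows "closed {x + y | x y. x \<in> S \<and> y \<in> T}" (is "closed ?P")
proof -
  have "z \<in> ?P" if z: "z \<in> closure ?P" for z
  proof -
    define M where "M n = {x \<in> S. \<exists>y\<in>T. norm (z - x - y) \<le> 1 / real (Suc n)}" for n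
    define C where "C n = closure (M n)" for n
    have MS: "M n \<subseteq> S" for n by (auto simp: M_def)
    have CS: "C n \<subseteq> S" for n unfolding C_def by (rule closure_minimal[OF MS S(1)])
    have "convex (M n)" for n
      unfolding convex_def
    proof (intro ballI allI impI)
      fix x x' and u v :: real assume x: "x \<in> M n" "x' \<in> M n" and uv: "0 \<le> u" "0 \<le> v" "u + v = 1"
      obtain y y' where y: "y \<in> T" "norm (z - x - y) \<le> 1 / real (Suc n)"
        "y' \<in> T" "norm (z - x' - y') \<le> 1 / real (Suc n)" using x by (auto simp: M_def)
      have "z - (u *\<^sub>R x + v *\<^sub>R x') - (u *\<^sub>R y + v *\<^sub>R y')
          = (u + v) *\<^sub>R z - (u *\<^sub>R x + v *\<^sub>R x') - (u *\<^sub>R y + v *\<^sub>R y')" by (simp add: uv)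
      also have "\<dots> = u *\<^sub>R (z - x - y) + v *\<^sub>R (z - x' - y')" by (simp add: algebra_simps)
      also have "norm \<dots> \<le> u * (1 / real (Suc n)) + v * (1 / real (Suc n))"
        using mult_left_mono[OF y(2) uv(1)] mult_left_mono[OF y(4) uv(2)] uv(1,2)
        by (intro norm_triangle_le add_mono) simp_all
      also have "\<dots> = 1 / real (Suc n)" using uv(3) by (simp flip: add_divide_distrib)
      finally have "norm (z - (u *\<^sub>R x + v *\<^sub>R x') - (u *\<^sub>R y + v *\<^sub>R y')) \<le> 1 / real (Suc n)" .
      moreover have "u *\<^sub>R y + v *\<^sub>R y' \<in> T" using T(2) y uv by (auto simp: convex_def)
      moreover have "u *\<^sub>R x + v *\<^sub>R x' \<in> S" using S(2) x uv by (auto simp: convex_def M_def)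
      ultimately show "u *\<^sub>R x + v *\<^sub>R x' \<in> M n" by (auto simp: M_def)
    qed
    then have cvx: "convex (C n)" for n by (simp add: C_def)
    have ne: "C n \<noteq> {}" for n
    proof -
      obtain x y where "x \<in> S" "y \<in> T" "dist (x + y) z < 1 / real (Suc n)"
        using z[unfolded closure_approachable, rule_format, of "1 / real (Suc n)"] by auto
      then have "x \<in> M n"
        by (auto simp: M_def dist_norm norm_minus_commute diff_diff_eq intro!: bexI[of _ y])
      then show ?thesis by (auto simp: C_def)
    qed
    have dec: "decseq C"
    proof (rule decseq_SucI)
      fix n have "1 / real (Suc (Suc n)) \<le> 1 / real (Suc n)" by (simp add: field_simps)
      then show "C (Suc n) \<le> C n"
        unfolding C_def by (intro closure_mono) (force simp: M_def)
    qed
    obtain x where x: "\<And>n. x \<in> C n"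
      using nested_convex_Inter_nonempty[of C] cvx ne dec bounded_subset[OF S(3) CS]
      by (auto simp: C_def)
    have "z - x \<in> closure T"
      unfolding closure_approachable
    proof (intro allI impI)
      fix e :: real assume "e > 0"
      then obtain n where n: "1 / real (Suc n) < e / 2" using nat_approx_posE[of "e / 2"] by auto
      obtain x' where x': "x' \<in> M n" "dist x' x < e / 2"
        using x[of n] \<open>e > 0\<close> unfolding C_def closure_approachable by (meson half_gt_zero)
      obtain y where y: "y \<in> T" "norm (z - x' - y) \<le> 1 / real (Suc n)" using x' by (auto simp: M_def)
      have "dist y (z - x) = norm ((z - x' - y) + (x' - x))"
        using norm_minus_commute[of y "z - x"] by (simp add: dist_norm algebra_simps)
      also have "\<dots> < e" using y(2) n x'(2) norm_triangle_ineq[of "z - x' - y" "x' - x"] by (simp add: dist_norm)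
      finally show "\<exists>y\<in>T. dist y (z - x) < e" using y by blast
    qed
    then have "z - x \<in> T" using T(1) by simp
    moreover have "x \<in> S" using x CS by blast
    moreover have "z = x + (z - x)" by simp
    ultimately show ?thesis by blast
  qed
  then show ?thesis using closure_subset_eq by blast
qed

section \<open>Smooth convex functions and approximate strong duality\<close>

lemma gderiv_convex_tangent:
  fixes f :: "'a::real_inner \<Rightarrow> real"
  assumes "convex_on UNIV f" and g: "GDERIV f x :> g"
  shows "f x + g \<bullet> (y - x) \<le> f y"
proof -
  define h where "h s = f (x + s *\<^sub>R (y - x))" for s :: real
  have "((\<lambda>s. x + s *\<^sub>R (y - x)) has_derivative (\<lambda>s. s *\<^sub>R (y - x))) (at 0)"
    by (auto intro!: derivative_eq_intros)
  moreover have "(f has_derivative (\<lambda>k. k \<bullet> g)) (at (x + 0 *\<^sub>R (y - x)))"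
    using g by (simp add: gderiv_def)
  ultimately have "(h has_derivative (\<lambda>s. (s *\<^sub>R (y - x)) \<bullet> g)) (at 0)"
    unfolding h_def by (rule has_derivative_compose)
  then have "(h has_real_derivative (g \<bullet> (y - x))) (at 0)"
    unfolding has_field_derivative_def
    by (rule has_derivative_eq_rhs) (auto simp: fun_eq_iff inner_commute)
  then have "((\<lambda>s. (h s - h 0) / s) \<longlongrightarrow> g \<bullet> (y - x)) (at 0)"
    by (simp add: has_field_derivative_iff)
  then have "((\<lambda>s. (h s - h 0) / s) \<longlongrightarrow> g \<bullet> (y - x)) (at_right 0)"
    by (rule filterlim_mono) (auto intro: at_le)
  moreover have "(h s - h 0) / s \<le> f y - f x" if "0 < s" "s < 1" for s
  proof -
    have "f ((1 - s) *\<^sub>R x + s *\<^sub>R y) \<le> (1 - s) * f x + s * f y"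
      using that by (intro convex_onD[OF assms(1)]) auto
    then show ?thesis using that by (simp add: h_def field_simps)
  qed
  then have "\<forall>\<^sub>F s in at_right 0. (h s - h 0) / s \<le> f y - f x"
    by (auto simp: eventually_at_right_field intro: exI[of _ 1])
  ultimately have "g \<bullet> (y - x) \<le> f y - f x"
    by (rule tendsto_upperbound) simp
  then show ?thesis by simp
qed

text \<open>The common route to first-order optimality: minimality along a segment and a quadratic
  upper bound give the hypothesis, and for small \<open>s\<close> the linear term dominates.\<close>

lemma nonneg_if_quadratic_nonneg:
  fixes a M :: real
  assumes "\<And>s. 0 < s \<Longrightarrow> s \<le> 1 \<Longrightarrow> 0 \<le> s * a + s\<^sup>2 * M"
  shows "0 \<le> a"
proof (rule ccontr)
  assume "\<not> 0 \<le> a"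
  define s where "s = min 1 (- a / (2 * (\<bar>M\<bar> + 1)))"
  have s: "0 < s" "s \<le> 1" using \<open>\<not> 0 \<le> a\<close> by (auto simp: s_def divide_neg_pos)
  have "s * (\<bar>M\<bar> + 1) \<le> - a / (2 * (\<bar>M\<bar> + 1)) * (\<bar>M\<bar> + 1)"
    by (intro mult_right_mono) (auto simp: s_def)
  also have "\<dots> = - a / 2" by (simp add: field_simps)
  finally have "s * (\<bar>M\<bar> + 1) \<le> - a / 2" .
  moreover have "s * M \<le> s * (\<bar>M\<bar> + 1)" using s by (intro mult_left_mono) auto
  ultimately have "a + s * M < 0" using \<open>\<not> 0 \<le> a\<close> by linarith
  then have "s * (a + s * M) < 0" using s by (simp add: mult_pos_neg)
  then show False using assms[OF s] by (simp add: power2_eq_square algebra_simps)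
qed

text \<open>The conjugate of \<open>\<iota>\<^sub>Q + \<parallel>\<cdot>\<parallel>\<^sup>2/2\<close>, a smooth function with gradient \<^term>\<open>metric_proj Q\<close>.\<close>

definition proj_potential :: "'b::real_inner set \<Rightarrow> 'b \<Rightarrow> real" where
  "proj_potential Q y = metric_proj Q y \<bullet> y - (norm (metric_proj Q y))\<^sup>2 / 2"

context
  fixes Q :: "'b::{real_inner,complete_space} set"
  assumes Q: "closed Q" "convex Q" "Q \<noteq> {}"
begin

lemma proj_potential_eq_infdist: "proj_potential Q y = ((norm y)\<^sup>2 - (infdist y Q)\<^sup>2) / 2"
  unfolding proj_potential_def metric_proj_dist[OF Q, symmetric] dist_norm
  by (simp add: power2_norm_eq_inner algebra_simps inner_commute)

lemma proj_potential_ge: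
  assumes "q \<in> Q"
  shows "q \<bullet> y - (norm q)\<^sup>2 / 2 \<le> proj_potential Q y"
proof -
  let ?p = "metric_proj Q y"
  have "proj_potential Q y - (q \<bullet> y - (norm q)\<^sup>2 / 2) = (norm (?p - q))\<^sup>2 / 2 - (y - ?p) \<bullet> (q - ?p)"
    unfolding proj_potential_def by (simp add: power2_norm_eq_inner inner_simps inner_commute field_simps)
  then show ?thesis
    using metric_proj_obtuse[OF Q(1,2) assms, of y] by (smt (verit) zero_le_power2 divide_nonneg_pos)
qed

text \<open>The projection at \<open>y + d\<close> competes in the supremum defining the potential
  at \<open>y\<close>, so the increment is at most its inner product with \<open>d\<close>;
  nonexpansiveness compares it with the projection at \<open>y\<close>.\<close>

lemma proj_potential_quadratic_upper:
  "proj_potential Q (y + d) \<le> proj_potential Q y + metric_proj Q y \<bullet> d + (norm d)\<^sup>2"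
proof -
  let ?p = "metric_proj Q y" and ?p' = "metric_proj Q (y + d)"
  have "?p' \<bullet> y - (norm ?p')\<^sup>2 / 2 \<le> proj_potential Q y"
    by (intro proj_potential_ge metric_proj_in Q)
  then have "proj_potential Q (y + d) \<le> proj_potential Q y + ?p \<bullet> d + (?p' - ?p) \<bullet> d"
    unfolding proj_potential_def[of Q "y + d"] by (simp add: inner_simps)
  moreover have "(?p' - ?p) \<bullet> d \<le> norm (?p' - ?p) * norm d" by (rule norm_cauchy_schwarz)
  moreover have "norm (?p' - ?p) * norm d \<le> norm d * norm d"
    using metric_proj_nonexpansive[OF Q, of "y + d" y] by (intro mult_right_mono) auto
  ultimately show ?thesis by (simp add: power2_eq_square)
qed

end

section \<open>Smooth convex functions and their Bregman distance\<close>

locale smooth_convex =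
  fixes f :: "'a::{real_inner,complete_space} \<Rightarrow> real" and gradf :: "'a \<Rightarrow> 'a" and \<beta> :: real
  assumes f_convex: "convex_on UNIV f"
    and f_grad: "\<And>x. GDERIV f x :> gradf x"
    and f_smooth: "\<beta> > 0" "\<beta>-lipschitz_on UNIV gradf"
begin

lemma tangent: "f x + gradf x \<bullet> (y - x) \<le> f y"
  using gderiv_convex_tangent[OF f_convex f_grad] .

lemma continuous_f: "continuous_on S f"
  by (intro continuous_at_imp_continuous_on ballI has_derivative_continuous[OF f_grad[unfolded gderiv_def]])

text \<open>The tangent at \<open>x + d\<close>, evaluated at \<open>x\<close>, replaces integration
  of the gradient; hence the factor \<open>\<beta>\<close> and not
  \<open>\<beta> / 2\<close>.\<close>

lemma quadratic_upper: "f (x + d) \<le> f x + gradf x \<bullet> d + \<beta> * (norm d)\<^sup>2"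
proof -
  have "f (x + d) \<le> f x + gradf x \<bullet> d + (gradf (x + d) - gradf x) \<bullet> d"
    using tangent[of "x + d" x] by (simp add: inner_simps)
  also have "(gradf (x + d) - gradf x) \<bullet> d \<le> norm (gradf (x + d) - gradf x) * norm d"
    by (rule norm_cauchy_schwarz)
  also have "\<dots> \<le> (\<beta> * norm d) * norm d"
    using lipschitz_onD[OF f_smooth(2), of "x + d" x] by (intro mult_right_mono) (auto simp: dist_norm)
  finally show ?thesis by (simp add: power2_eq_square mult.assoc)
qed

definition bregman :: "'a \<Rightarrow> 'a \<Rightarrow> real" where
  "bregman x y = f y - f x - gradf x \<bullet> (y - x)"

lemma bregman_nonneg: "0 \<le> bregman x y"
  using tangent[of x y] by (simp add: bregman_def)

lemma bregman_upper: "bregman x y \<le> \<beta> * (norm (y - x))\<^sup>2"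
  using quadratic_upper[of x "y - x"] by (simp add: bregman_def)

text \<open>At \<open>y + - (c *\<^sub>R d)\<close> the tangent at \<open>x\<close> bounds
  \<open>f\<close> below and the quadratic bound at \<open>y\<close> bounds it above;
  \<open>c = 1 / (2 * \<beta>)\<close> is the best step for the latter. Dually this is strong
  convexity of the conjugate.\<close>

lemma bregman_cocoercive: "(norm (gradf x - gradf y))\<^sup>2 / (4 * \<beta>) \<le> bregman x y"
proof -
  define d where "d = gradf y - gradf x"
  define c where "c = 1 / (2 * \<beta>)"
  have "f x + gradf x \<bullet> (y - x) - c * (gradf x \<bullet> d) \<le> f (y + - (c *\<^sub>R d))"
    using tangent[of x "y + - (c *\<^sub>R d)"] by (simp add: inner_simps)
  also have "\<dots> \<le> f y - c * (gradf y \<bullet> d) + \<beta> * c\<^sup>2 * (norm d)\<^sup>2"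
    using quadratic_upper[of y "- (c *\<^sub>R d)"] by (simp add: power_mult_distrib mult.assoc)
  finally have "c * (d \<bullet> d) - \<beta> * c\<^sup>2 * (norm d)\<^sup>2 \<le> bregman x y"
    by (simp add: bregman_def d_def inner_simps algebra_simps)
  moreover have "c * (d \<bullet> d) - \<beta> * c\<^sup>2 * (norm d)\<^sup>2 = (norm d)\<^sup>2 / (4 * \<beta>)"
    using f_smooth(1) by (simp add: c_def dot_square_norm field_simps power2_eq_square)
  ultimately show ?thesis by (simp add: d_def norm_minus_commute)
qed

text \<open>Regularising \<open>\<sigma>\<^sub>Q\<close> to \<open>sup\<^sub>q \<langle>q, z\<rangle> - \<epsilon>\<parallel>q\<parallel>\<^sup>2/2\<close> makes the primal objective differentiable,
  and the optimality condition of the regularised problem yields the dual point; weak compactness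
  enters only through nested closed convex sets.\<close>

lemma approximate_strong_duality:
  fixes A :: "'a \<Rightarrow> 'b::{real_inner,complete_space}"
  assumes A: "bounded_linear A" and Q: "closed Q" "convex Q" "Q \<noteq> {}"
    and C: "closed C" "convex C" "bounded C" "C \<noteq> {}"
    and lower: "\<And>u r. u \<in> C \<Longrightarrow> (\<And>q. q \<in> Q \<Longrightarrow> q \<bullet> (A u - b) \<le> r) \<Longrightarrow> m \<le> f u + r"
    and "\<delta> > 0"
  obtains u q where "u \<in> C" "q \<in> Q"
    "\<And>x. x \<in> C \<Longrightarrow> m - \<delta> \<le> f u + gradf u \<bullet> (x - u) + q \<bullet> (A x - b)"
proof -
  interpret A: bounded_linear A by fact
  \<comment> \<open>Sublevel sets of the regularised objective, written as intersections over
    \<open>Q\<close> so that closedness and convexity can be checked constraint by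
    constraint.\<close>
  define Lev where "Lev \<epsilon> c = C \<inter> (\<Inter>q\<in>Q. {u. f u + q \<bullet> (A u - b) - \<epsilon> / 2 * (norm q)\<^sup>2 \<le> c})" for \<epsilon> c
  have closed: "closed (Lev \<epsilon> c)" for \<epsilon> c
    unfolding Lev_def
    by (intro closed_Int C closed_INT ballI closed_Collect_le continuous_intros continuous_f A.continuous_on)
  have convex: "convex (Lev \<epsilon> c)" for \<epsilon> c
    unfolding Lev_def
  proof (intro convex_Int C convex_INT)
    fix q show "convex {u. f u + q \<bullet> (A u - b) - \<epsilon> / 2 * (norm q)\<^sup>2 \<le> c}"
      unfolding convex_def
    proof (safe)
      fix x y and s t :: real
      assume x: "f x + q \<bullet> (A x - b) - \<epsilon> / 2 * (norm q)\<^sup>2 \<le> c"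
        and y: "f y + q \<bullet> (A y - b) - \<epsilon> / 2 * (norm q)\<^sup>2 \<le> c" and st: "0 \<le> s" "0 \<le> t" "s + t = 1"
      have "f (s *\<^sub>R x + t *\<^sub>R y) \<le> s * f x + t * f y"
        using f_convex st by (simp add: convex_on_def)
      moreover have "q \<bullet> (A (s *\<^sub>R x + t *\<^sub>R y) - b) = s * (q \<bullet> (A x - b)) + t * (q \<bullet> (A y - b))"
      proof -
        have "A (s *\<^sub>R x + t *\<^sub>R y) - b = A (s *\<^sub>R x + t *\<^sub>R y) - (s + t) *\<^sub>R b" by (simp add: st)
        also have "\<dots> = s *\<^sub>R (A x - b) + t *\<^sub>R (A y - b)"
          by (simp add: A.add A.scaleR algebra_simps)
        finally show ?thesis by (simp add: inner_simps)
      qed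
      moreover have "s * (f x + q \<bullet> (A x - b)) + t * (f y + q \<bullet> (A y - b))
          \<le> s * (c + \<epsilon> / 2 * (norm q)\<^sup>2) + t * (c + \<epsilon> / 2 * (norm q)\<^sup>2)"
        using x y by (intro add_mono[OF mult_left_mono[OF _ st(1)] mult_left_mono[OF _ st(2)]]) auto
      moreover have "s * (c + \<epsilon> / 2 * (norm q)\<^sup>2) + t * (c + \<epsilon> / 2 * (norm q)\<^sup>2) = c + \<epsilon> / 2 * (norm q)\<^sup>2"
        using st(3) by (simp flip: distrib_right)
      ultimately show "f (s *\<^sub>R x + t *\<^sub>R y) + q \<bullet> (A (s *\<^sub>R x + t *\<^sub>R y) - b) - \<epsilon> / 2 * (norm q)\<^sup>2 \<le> c"
        by (simp add: algebra_simps)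
    qed
  qed
  have bdd: "bounded (Lev \<epsilon> c)" for \<epsilon> c
    using C(3) by (rule bounded_subset) (auto simp: Lev_def)
  \<comment> \<open>Otherwise a common point \<open>u\<close> would satisfy, as the regularisation
    tends to 0, \<open>q \<bullet> (A u - b) \<le> m - \<delta> - f u\<close> on all of
    \<open>Q\<close>, against \<open>lower\<close>.\<close>
  have "\<exists>n. Lev (1 / real (Suc n)) (m - \<delta>) = {}"
  proof (rule ccontr)
    assume "\<not> ?thesis"
    then have ne: "\<And>n. Lev (1 / real (Suc n)) (m - \<delta>) \<noteq> {}" by blast
    have dec: "decseq (\<lambda>n. Lev (1 / real (Suc n)) (m - \<delta>))"
    proof (rule decseq_SucI)
      fix n
      have "1 / real (Suc (Suc n)) / 2 * (norm q)\<^sup>2 \<le> 1 / real (Suc n) / 2 * (norm q)\<^sup>2" for q :: 'b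
        by (intro mult_right_mono divide_right_mono) (auto simp: field_simps)
      then show "Lev (1 / real (Suc (Suc n))) (m - \<delta>) \<le> Lev (1 / real (Suc n)) (m - \<delta>)"
        unfolding Lev_def by (intro Int_mono INF_mono order_refl) (smt (verit) mem_Collect_eq subsetI)
    qed
    obtain u where u: "\<And>n. u \<in> Lev (1 / real (Suc n)) (m - \<delta>)"
      using nested_convex_Inter_nonempty[of "\<lambda>n. Lev (1 / real (Suc n)) (m - \<delta>)", OF closed convex ne dec bdd]
      by blast
    have "q \<bullet> (A u - b) \<le> m - \<delta> - f u" if "q \<in> Q" for q
    proof (rule LIMSEQ_le_const2)
      have "(\<lambda>n. f u + q \<bullet> (A u - b) - 1 / real (Suc n) / 2 * (norm q)\<^sup>2 - f u)
          \<longlonglongrightarrow> f u + q \<bullet> (A u - b) - 0 / 2 * (norm q)\<^sup>2 - f u"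
        by (intro tendsto_intros LIMSEQ_Suc[OF lim_1_over_n]) simp
      then show "(\<lambda>n. f u + q \<bullet> (A u - b) - 1 / real (Suc n) / 2 * (norm q)\<^sup>2 - f u)
          \<longlonglongrightarrow> q \<bullet> (A u - b)" by simp
      show "\<exists>N. \<forall>n\<ge>N. f u + q \<bullet> (A u - b) - 1 / real (Suc n) / 2 * (norm q)\<^sup>2 - f u \<le> m - \<delta> - f u"
        using u that unfolding Lev_def by (simp add: algebra_simps)
    qed
    then have "m \<le> f u + (m - \<delta> - f u)" using u[of 0] by (intro lower) (auto simp: Lev_def)
    then show False using \<open>\<delta> > 0\<close> by simp
  qed
  then obtain n where n: "Lev (1 / real (Suc n)) (m - \<delta>) = {}" by blast
  define \<epsilon> where "\<epsilon> = 1 / real (Suc n)"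
  have e: "\<epsilon> > 0" by (simp add: \<epsilon>_def)
  \<comment> \<open>By scaling, the second term is the supremum over \<open>q \<in> Q\<close> of
    \<open>q \<bullet> (A u - b) - \<epsilon> / 2 * (norm q)\<^sup>2\<close>, attained at the
    projection of the scaled residual.\<close>
  define \<Phi> where "\<Phi> u = f u + \<epsilon> * proj_potential Q ((A u - b) /\<^sub>R \<epsilon>)" for u
  have scale: "q \<bullet> (A u - b) = \<epsilon> * (q \<bullet> ((A u - b) /\<^sub>R \<epsilon>))" for u q
    using e by simp
  have Phi_ge: "f u + q \<bullet> (A u - b) - \<epsilon> / 2 * (norm q)\<^sup>2 \<le> \<Phi> u" if "q \<in> Q" for u q
    using mult_left_mono[OF proj_potential_ge[OF Q that, of "(A u - b) /\<^sub>R \<epsilon>"], of \<epsilon>] e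
    unfolding \<Phi>_def scale by (simp only: right_diff_distrib) simp
  have Phi_eq: "\<Phi> u = f u + q \<bullet> (A u - b) - \<epsilon> / 2 * (norm q)\<^sup>2"
    if "q = metric_proj Q ((A u - b) /\<^sub>R \<epsilon>)" for u q
    unfolding \<Phi>_def scale proj_potential_def that by (simp add: right_diff_distrib)
  have Lev_iff: "u \<in> Lev \<epsilon> c \<longleftrightarrow> u \<in> C \<and> \<Phi> u \<le> c" for u c
  proof
    assume "u \<in> Lev \<epsilon> c"
    then show "u \<in> C \<and> \<Phi> u \<le> c"
      using Phi_eq[OF refl, of u] metric_proj_in[OF Q] by (auto simp: Lev_def)
  next
    assume "u \<in> C \<and> \<Phi> u \<le> c"
    then show "u \<in> Lev \<epsilon> c" using Phi_ge[of _ u] by (force simp: Lev_def)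
  qed
  have Phi_gt: "m - \<delta> < \<Phi> u" if "u \<in> C" for u
    using n Lev_iff[of u "m - \<delta>"] that by (force simp: \<epsilon>_def)
  define I where "I = (INF u\<in>C. \<Phi> u)"
  have bb: "bdd_below (\<Phi> ` C)" using Phi_gt by (force intro!: bdd_belowI[of _ "m - \<delta>"])
  have ne: "Lev \<epsilon> (I + 1 / real (Suc k)) \<noteq> {}" for k
  proof -
    have "Inf (\<Phi> ` C) < I + 1 / real (Suc k)" by (simp add: I_def)
    then obtain u where "u \<in> C" "\<Phi> u < I + 1 / real (Suc k)"
      using cInf_lessD[of "\<Phi> ` C"] C(4) by blast
    then show ?thesis using Lev_iff by force
  qed
  have "decseq (\<lambda>k. Lev \<epsilon> (I + 1 / real (Suc k)))"
  proof (rule decseq_SucI)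
    fix k have "1 / real (Suc (Suc k)) \<le> 1 / real (Suc k)" by (simp add: field_simps)
    then show "Lev \<epsilon> (I + 1 / real (Suc (Suc k))) \<le> Lev \<epsilon> (I + 1 / real (Suc k))"
      using Lev_iff by (smt (verit) subsetI)
  qed
  then obtain u where u: "\<And>k. u \<in> Lev \<epsilon> (I + 1 / real (Suc k))"
    using nested_convex_Inter_nonempty[of "\<lambda>k. Lev \<epsilon> (I + 1 / real (Suc k))", OF closed convex ne _ bdd]
    by blast
  have uC: "u \<in> C" using u Lev_iff by blast
  have "\<Phi> u \<le> I"
  proof (rule LIMSEQ_le_const)
    show "(\<lambda>k. I + 1 / real (Suc k)) \<longlonglongrightarrow> I"
      using tendsto_add[OF tendsto_const LIMSEQ_Suc[OF lim_1_over_n], of I] by simp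
  qed (use u Lev_iff in blast)
  then have min: "\<Phi> u \<le> \<Phi> x" if "x \<in> C" for x
    using cINF_lower[OF bb that] by (simp add: I_def)
  define q where "q = metric_proj Q ((A u - b) /\<^sub>R \<epsilon>)"
  \<comment> \<open>First-order optimality of the regularised minimiser \<open>u\<close> towards
    \<open>x\<close>; the penalty contained in \<open>\<Phi> u\<close> has the sign that allows
    dropping it.\<close>
  have "m - \<delta> \<le> f u + gradf u \<bullet> (x - u) + q \<bullet> (A x - b)" if x: "x \<in> C" for x
  proof -
    define d where "d = x - u"
    have "0 \<le> gradf u \<bullet> d + q \<bullet> A d"
    proof (rule nonneg_if_quadratic_nonneg)
      fix s :: real assume s: "0 < s" "s \<le> 1"
      have "u + s *\<^sub>R d \<in> C"
        using convexD_alt[OF C(2) uC x, of s] s by (simp add: d_def algebra_simps)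
      then have "\<Phi> u \<le> \<Phi> (u + s *\<^sub>R d)" by (rule min)
      moreover have "f (u + s *\<^sub>R d) \<le> f u + s * (gradf u \<bullet> d) + s\<^sup>2 * (\<beta> * (norm d)\<^sup>2)"
        using quadratic_upper[of u "s *\<^sub>R d"] by (simp add: power_mult_distrib algebra_simps)
      moreover have "\<epsilon> * proj_potential Q ((A (u + s *\<^sub>R d) - b) /\<^sub>R \<epsilon>)
          \<le> \<epsilon> * (proj_potential Q ((A u - b) /\<^sub>R \<epsilon>) + s / \<epsilon> * (q \<bullet> A d) + (s / \<epsilon>)\<^sup>2 * (norm (A d))\<^sup>2)"
      proof (rule mult_left_mono)
        have "(A (u + s *\<^sub>R d) - b) /\<^sub>R \<epsilon> = (A u - b) /\<^sub>R \<epsilon> + (s / \<epsilon>) *\<^sub>R A d"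
          by (simp add: A.add A.scaleR algebra_simps divide_inverse_commute)
        then show "proj_potential Q ((A (u + s *\<^sub>R d) - b) /\<^sub>R \<epsilon>)
          \<le> proj_potential Q ((A u - b) /\<^sub>R \<epsilon>) + s / \<epsilon> * (q \<bullet> A d) + (s / \<epsilon>)\<^sup>2 * (norm (A d))\<^sup>2"
          using proj_potential_quadratic_upper[OF Q, of "(A u - b) /\<^sub>R \<epsilon>" "(s / \<epsilon>) *\<^sub>R A d"]
          by (simp add: q_def power_mult_distrib power_divide)
      qed (use e in simp)
      moreover have "\<epsilon> * (proj_potential Q ((A u - b) /\<^sub>R \<epsilon>) + s / \<epsilon> * (q \<bullet> A d) + (s / \<epsilon>)\<^sup>2 * (norm (A d))\<^sup>2)
          = \<epsilon> * proj_potential Q ((A u - b) /\<^sub>R \<epsilon>) + s * (q \<bullet> A d) + s\<^sup>2 * ((norm (A d))\<^sup>2 / \<epsilon>)"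
        using e by (simp add: field_simps power2_eq_square)
      ultimately show "0 \<le> s * (gradf u \<bullet> d + q \<bullet> A d) + s\<^sup>2 * (\<beta> * (norm d)\<^sup>2 + (norm (A d))\<^sup>2 / \<epsilon>)"
        by (simp add: \<Phi>_def algebra_simps)
    qed
    then have "\<Phi> u \<le> f u + gradf u \<bullet> (x - u) + q \<bullet> (A x - b) - \<epsilon> / 2 * (norm q)\<^sup>2"
      using Phi_eq[OF q_def] by (simp add: d_def A.diff inner_simps)
    moreover have "0 \<le> \<epsilon> / 2 * (norm q)\<^sup>2" using e by simp
    ultimately show ?thesis using Phi_gt[OF uC] by linarith
  qed
  moreover have "q \<in> Q" using metric_proj_in[OF Q] by (simp add: q_def)
  ultimately show ?thesis using that[OF uC] by blast
qed

end

section \<open>Moments of Radon measures\<close>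

text \<open>Supplies the test directions for the candidate problem: \<open>a = 1\<close> adds an
  atom at \<open>u\<close>, and \<open>r = 0\<close> with \<open>a < 1\<close> shrinks
  \<open>\<nu>\<close>.\<close>

definition add_point_mass :: "real \<Rightarrow> 'a::metric_space measure \<Rightarrow> real \<Rightarrow> 'a \<Rightarrow> 'a measure" where
  "add_point_mass a \<nu> r u =
     measure_of (space \<nu>) (sets \<nu>) (\<lambda>B. ennreal a * emeasure \<nu> B + ennreal r * indicator B u)"

lemma space_add_point_mass [simp]: "space (add_point_mass a \<nu> r u) = space \<nu>"
  and sets_add_point_mass [simp, measurable_cong]: "sets (add_point_mass a \<nu> r u) = sets \<nu>"
  by (simp_all add: add_point_mass_def)

lemma emeasure_add_point_mass:
  assumes "B \<in> sets \<nu>"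
  shows "emeasure (add_point_mass a \<nu> r u) B = ennreal a * emeasure \<nu> B + ennreal r * indicator B u"
  unfolding add_point_mass_def
proof (rule emeasure_measure_of_sigma)
  show "countably_additive (sets \<nu>) (\<lambda>B. ennreal a * emeasure \<nu> B + ennreal r * indicator B u)"
  proof (rule countably_additiveI)
    fix F :: "nat \<Rightarrow> 'a set"
    assume F: "range F \<subseteq> sets \<nu>" "disjoint_family F" "(\<Union>i. F i) \<in> sets \<nu>"
    have "(\<Sum>i. indicator (F i) u) = (indicator (\<Union>i. F i) u :: ennreal)"
      using F(2) by (rule suminf_indicator)
    then show "(\<Sum>i. ennreal a * emeasure \<nu> (F i) + ennreal r * indicator (F i) u)
        = ennreal a * emeasure \<nu> (\<Union>i. F i) + ennreal r * indicator (\<Union>i. F i) u"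
      using suminf_emeasure[OF F(1,2)] by (simp add: suminf_add[symmetric] ennreal_suminf_cmult)
  qed
qed (use assms in \<open>auto simp: positive_def sets.sigma_algebra_axioms\<close>)

lemma nn_integral_add_point_mass:
  assumes "g \<in> borel_measurable \<nu>" and u: "u \<in> space \<nu>"
  shows "(\<integral>\<^sup>+x. g x \<partial>add_point_mass a \<nu> r u) = ennreal a * (\<integral>\<^sup>+x. g x \<partial>\<nu>) + ennreal r * g u"
  using assms(1)
proof (induct g rule: borel_measurable_induct)
  case (cong f g)
  then have "(\<integral>\<^sup>+x. f x \<partial>M) = (\<integral>\<^sup>+x. g x \<partial>M)" if "space M = space \<nu>" for M
    using that by (intro nn_integral_cong) simp
  then show ?case using cong u by simp
next
  case (set B)
  then show ?case by (simp add: emeasure_add_point_mass)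
next
  case (mult g c)
  then show ?case by (simp add: nn_integral_cmult algebra_simps)
next
  case (add g h)
  then show ?case by (simp add: nn_integral_add algebra_simps)
next
  case (seq U)
  have inc: "incseq (\<lambda>i. \<integral>\<^sup>+x. U i x \<partial>\<nu>)" "incseq (\<lambda>i. U i u)"
    using seq(4) by (auto simp: incseq_def le_fun_def intro!: nn_integral_mono)
  have mono: "incseq (\<lambda>i. c * h i)" if "incseq h" for c :: ennreal and h :: "nat \<Rightarrow> ennreal"
    using that by (auto simp: incseq_def intro: mult_left_mono)
  have "(\<integral>\<^sup>+x. (SUP i. U i) x \<partial>add_point_mass a \<nu> r u) = (SUP i. \<integral>\<^sup>+x. U i x \<partial>add_point_mass a \<nu> r u)"
    using seq by (simp add: image_comp nn_integral_monotone_convergence_SUP)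
  also have "\<dots> = (SUP i. ennreal a * (\<integral>\<^sup>+x. U i x \<partial>\<nu>) + ennreal r * U i u)"
    using seq(3) by simp
  also have "\<dots> = (SUP i. ennreal a * (\<integral>\<^sup>+x. U i x \<partial>\<nu>)) + (SUP i. ennreal r * U i u)"
    by (intro ennreal_SUP_add mono inc)
  also have "\<dots> = ennreal a * (SUP i. \<integral>\<^sup>+x. U i x \<partial>\<nu>) + ennreal r * (SUP i. U i u)"
    by (simp add: SUP_mult_left_ennreal)
  also have "(SUP i. \<integral>\<^sup>+x. U i x \<partial>\<nu>) = (\<integral>\<^sup>+x. (SUP i. U i) x \<partial>\<nu>)"
    using seq by (simp add: image_comp nn_integral_monotone_convergence_SUP)
  finally show ?case by (simp add: image_comp)
qed

lemma integral_add_point_mass: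
  fixes g :: "'a::metric_space \<Rightarrow> real"
  assumes g: "integrable \<nu> g" and u: "u \<in> space \<nu>" and a: "0 \<le> a" "0 \<le> r"
  shows "(LINT x|add_point_mass a \<nu> r u. g x) = a * (LINT x|\<nu>. g x) + r * g u"
proof -
  have [measurable]: "g \<in> borel_measurable \<nu>" using g by simp
  let ?N = "add_point_mass a \<nu> r u"
  have fin: "(\<integral>\<^sup>+x. ennreal (g x) \<partial>\<nu>) < top" "(\<integral>\<^sup>+x. ennreal (- g x) \<partial>\<nu>) < top"
    using g by (auto simp: real_integrable_def less_top)
  have nn: "(\<integral>\<^sup>+x. ennreal (g x) \<partial>?N) = ennreal a * (\<integral>\<^sup>+x. ennreal (g x) \<partial>\<nu>) + ennreal r * ennreal (g u)"
    "(\<integral>\<^sup>+x. ennreal (- g x) \<partial>?N) = ennreal a * (\<integral>\<^sup>+x. ennreal (- g x) \<partial>\<nu>) + ennreal r * ennreal (- g u)"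
    using u by (intro nn_integral_add_point_mass; measurable)+
  have "integrable ?N g"
    using fin by (auto simp: real_integrable_def nn ennreal_mult_eq_top_iff)
  then have "(LINT x|?N. g x) = enn2real (\<integral>\<^sup>+x. ennreal (g x) \<partial>?N) - enn2real (\<integral>\<^sup>+x. ennreal (- g x) \<partial>?N)"
    by (rule real_lebesgue_integral_def)
  also have "enn2real (\<integral>\<^sup>+x. ennreal (g x) \<partial>?N) = a * enn2real (\<integral>\<^sup>+x. ennreal (g x) \<partial>\<nu>) + r * max 0 (g u)"
    unfolding nn(1) using fin a by (subst enn2real_plus) (auto simp: ennreal_mult_less_top enn2real_mult max_def ennreal_neg)
  also have "enn2real (\<integral>\<^sup>+x. ennreal (- g x) \<partial>?N) = a * enn2real (\<integral>\<^sup>+x. ennreal (- g x) \<partial>\<nu>) + r * max 0 (- g u)"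
    unfolding nn(2) using fin a by (subst enn2real_plus) (auto simp: ennreal_mult_less_top enn2real_mult max_def ennreal_neg)
  finally show ?thesis
    unfolding real_lebesgue_integral_def[OF g] by (auto simp: max_def algebra_simps split: if_splits)
qed

section \<open>Mass and moment of a Radon measure\<close>

context
  fixes S :: "'a::{real_inner,complete_space} set" and \<nu> :: "'a measure"
  assumes \<nu>: "\<nu> \<in> radon_measures S"
begin

lemma radon_sets: "sets \<nu> = sets (restrict_space borel S)"
  and radon_finite: "finite_measure \<nu>"
  and radon_inner_regular: "B \<in> sets \<nu> \<Longrightarrow> emeasure \<nu> B = (SUP C\<in>{C. C \<subseteq> B \<and> compact C}. emeasure \<nu> C)"
  using \<nu> by (auto simp: radon_measures_def)

lemma radon_space: "space \<nu> = S"
  using sets_eq_imp_space_eq[OF radon_sets] by (simp add: space_restrict_space)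

lemma radon_compact_sets:
  assumes "compact C" "C \<subseteq> S"
  shows "C \<in> sets \<nu>"
  unfolding radon_sets sets_restrict_space using assms borel_compact[OF assms(1)] by (auto simp: image_iff)

lemma radon_add_point_mass:
  assumes u: "u \<in> S" and a: "0 \<le> a" "0 \<le> r"
  shows "add_point_mass a \<nu> r u \<in> radon_measures S"
  unfolding radon_measures_def
proof (intro CollectI conjI ballI)
  let ?N = "add_point_mass a \<nu> r u"
  show "sets ?N = sets (restrict_space borel S)" by (simp add: radon_sets)
  show "finite_measure ?N"
    using finite_measure.emeasure_finite[OF radon_finite]
    by (intro finite_measureI)
      (auto simp: emeasure_add_point_mass ennreal_mult_eq_top_iff split: split_indicator)
  fix B assume "B \<in> sets ?N"
  then have B: "B \<in> sets \<nu>" by simp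
  then have BS: "B \<subseteq> S" using sets.sets_into_space radon_space by blast
  let ?C = "{C. C \<subseteq> B \<and> compact C}"
  have Cs: "C \<in> sets \<nu>" if "C \<in> ?C" for C using that BS radon_compact_sets by auto
  show "emeasure ?N B = (SUP C\<in>?C. emeasure ?N C)"
  proof (rule antisym)
    show "(SUP C\<in>?C. emeasure ?N C) \<le> emeasure ?N B"
      using B by (intro SUP_least emeasure_mono) auto
    have "emeasure ?N B = (SUP C\<in>?C. ennreal a * emeasure \<nu> C) + ennreal r * indicator B u"
      using B by (simp add: emeasure_add_point_mass radon_inner_regular[OF B] SUP_mult_left_ennreal)
    also have "\<dots> = (SUP C\<in>?C. ennreal a * emeasure \<nu> C + ennreal r * indicator B u)"
      by (subst ennreal_SUP_add_left) auto
    also have "\<dots> \<le> (SUP C\<in>?C. emeasure ?N C)"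
    proof (rule SUP_least)
      fix C assume C: "C \<in> ?C"
      \<comment> \<open>Inner regularity survives the atom because inserting \<open>u\<close> keeps
        a compact set compact.\<close>
      define D where "D = (if u \<in> B then insert u C else C)"
      have D: "D \<in> ?C" using C by (auto simp: D_def)
      have "emeasure \<nu> C \<le> emeasure \<nu> D" using Cs[OF D] by (intro emeasure_mono) (auto simp: D_def)
      moreover have "(indicator B u :: ennreal) = indicator D u"
        using C by (auto simp: D_def indicator_def)
      ultimately have "ennreal a * emeasure \<nu> C + ennreal r * indicator B u \<le> emeasure ?N D"
        using Cs[OF D] by (auto simp: emeasure_add_point_mass intro!: add_mono mult_left_mono)
      also have "\<dots> \<le> (SUP C\<in>?C. emeasure ?N C)" using D by (rule SUP_upper)
      finally show "ennreal a * emeasure \<nu> C + ennreal r * indicator B u \<le> (SUP C\<in>?C. emeasure ?N C)" .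
    qed
    finally show "emeasure ?N B \<le> (SUP C\<in>?C. emeasure ?N C)" .
  qed
qed

lemma radon_integrable_inner:
  assumes "bounded S"
  shows "integrable \<nu> (\<lambda>x. c \<bullet> x)"
proof -
  obtain R where R: "\<And>x. x \<in> S \<Longrightarrow> norm x \<le> R" using assms by (auto simp: bounded_iff)
  have "(\<lambda>x. c \<bullet> x) \<in> borel_measurable (restrict_space borel S)"
    by (intro borel_measurable_continuous_on_restrict continuous_intros)
  then have "(\<lambda>x. c \<bullet> x) \<in> borel_measurable \<nu>"
    using measurable_cong_sets[OF radon_sets refl] by blast
  moreover have "norm (c \<bullet> x) \<le> norm c * R" if "x \<in> space \<nu>" for x
    using Cauchy_Schwarz_ineq2[of c x] mult_left_mono[OF R[of x], of "norm c"] that radon_space by auto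
  ultimately show ?thesis
    by (intro finite_measure.integrable_const_bound[OF radon_finite, of _ "norm c * R"] AE_I2)
qed

text \<open>\<open>neg_moment\<close> is a definite description: existence comes from Riesz
  representation of the integral functional, bounded since \<open>S\<close> is, and uniqueness from
  testing with the difference of two representatives.\<close>

lemma radon_neg_moment:
  assumes "bounded S"
  shows "c \<bullet> neg_moment \<nu> = - (LINT x|\<nu>. c \<bullet> x)"
proof -
  obtain R where R: "\<And>x. x \<in> S \<Longrightarrow> norm x \<le> R" using assms by (auto simp: bounded_iff)
  note int = radon_integrable_inner[OF assms]
  let ?\<phi> = "\<lambda>c. - (LINT x|\<nu>. c \<bullet> x)"
  have "bounded_linear ?\<phi>"
  proof (rule bounded_linear_intro)
    show "?\<phi> (x + y) = ?\<phi> x + ?\<phi> y" for x y by (simp add: inner_add_left int)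
    show "?\<phi> (s *\<^sub>R x) = s *\<^sub>R ?\<phi> x" for s x by simp
    show "norm (?\<phi> x) \<le> norm x * (R * measure \<nu> S)" for x
    proof -
      have "norm (?\<phi> x) \<le> (LINT y|\<nu>. norm (x \<bullet> y))" by (simp add: integral_norm_bound[of \<nu> "\<lambda>y. x \<bullet> y", simplified])
      also have "\<dots> \<le> (LINT y|\<nu>. norm x * R)"
      proof (rule integral_mono)
        show "integrable \<nu> (\<lambda>y. norm (x \<bullet> y))" using int by (rule integrable_norm)
        show "integrable \<nu> (\<lambda>y. norm x * R)"
          using finite_measure.integrable_const[OF radon_finite] .
        show "norm (x \<bullet> y) \<le> norm x * R" if "y \<in> space \<nu>" for y
          using Cauchy_Schwarz_ineq2[of x y] mult_left_mono[OF R[of y], of "norm x"] that radon_space by auto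
      qed
      also have "\<dots> = norm x * (R * measure \<nu> S)" by (simp add: radon_space)
      finally show ?thesis .
    qed
  qed
  then obtain e where e: "\<And>c. ?\<phi> c = c \<bullet> e" using riesz_representation by blast
  have "e' = e" if "\<forall>c. c \<bullet> e' = ?\<phi> c" for e'
  proof -
    have "(e' - e) \<bullet> (e' - e) = 0"
      using that e[of "e' - e"] by (subst inner_diff_right) simp
    then show ?thesis by simp
  qed
  then have "neg_moment \<nu> = e" unfolding neg_moment_def using e by (intro the_equality) auto
  then show ?thesis using e by simp
qed

text \<open>The form in which the multiplier enters later: a linear inequality on \<open>S\<close>
  is integrated against \<open>\<nu>\<close>. The minus signs undo the convention that mass and
  moment are those of the negative of \<open>\<nu>\<close>.\<close>

lemma radon_moment_mono:
  assumes "bounded S" and "\<And>x. x \<in> S \<Longrightarrow> c \<bullet> x \<le> k"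
  shows "- (c \<bullet> neg_moment \<nu>) \<le> k * - neg_mass S \<nu>"
proof -
  have "(LINT x|\<nu>. c \<bullet> x) \<le> (LINT x|\<nu>. k)"
    using assms radon_space finite_measure.integrable_const[OF radon_finite]
    by (intro integral_mono radon_integrable_inner) auto
  then show ?thesis by (simp add: radon_neg_moment[OF assms(1)] neg_mass_def radon_space mult.commute)
qed

end

lemma neg_moment_add_point_mass:
  fixes S :: "'a::{real_inner,complete_space} set"
  assumes \<nu>: "\<nu> \<in> radon_measures S" and S: "bounded S" "u \<in> S" and a: "0 \<le> a" "0 \<le> r"
  shows "neg_moment (add_point_mass a \<nu> r u) = a *\<^sub>R neg_moment \<nu> - r *\<^sub>R u"
    and "neg_mass S (add_point_mass a \<nu> r u) = a * neg_mass S \<nu> - r"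
proof -
  note N = radon_add_point_mass[OF \<nu> S(2) a]
  have u: "u \<in> space \<nu>" using S radon_space[OF \<nu>] by simp
  have "c \<bullet> neg_moment (add_point_mass a \<nu> r u) = c \<bullet> (a *\<^sub>R neg_moment \<nu> - r *\<^sub>R u)" for c
    unfolding radon_neg_moment[OF N S(1)]
    by (simp add: integral_add_point_mass[OF radon_integrable_inner[OF \<nu> S(1)] u a]
        inner_diff_right radon_neg_moment[OF \<nu> S(1)])
  then show "neg_moment (add_point_mass a \<nu> r u) = a *\<^sub>R neg_moment \<nu> - r *\<^sub>R u"
    using vector_eq_rdot by (metis inner_commute)
  have "S \<in> sets \<nu>" using sets.top[of \<nu>] radon_space[OF \<nu>] by simp
  moreover have "emeasure \<nu> S \<noteq> top" using finite_measure.emeasure_finite[OF radon_finite[OF \<nu>]] by (simp add: less_top)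
  ultimately show "neg_mass S (add_point_mass a \<nu> r u) = a * neg_mass S \<nu> - r"
    using S(2) a by (simp add: neg_mass_def measure_def emeasure_add_point_mass enn2real_plus
        enn2real_mult ennreal_mult_less_top less_top)
qed

section \<open>The dual candidate as a Bregman projection\<close>

context smooth_convex
begin

text \<open>For \<open>w \<in> \<partial>f\<^sup>*(\<mu>\<^sub>1)\<close>, i.e. \<open>\<mu>\<^sub>1 = \<nabla>f(w)\<close>, the value
  \<open>f\<^sup>*(\<mu>\<^sub>1) + \<langle>q, b\<rangle> - \<langle>\<mu>\<^sub>1 + A\<^sup>*q, u\<rangle>\<close> of the cut induced by \<open>u \<in> K\<close> on the dual objective.
  Likewise \<^term>\<open>bregman w' w\<close> is the Bregman distance of \<open>f\<^sup>*\<close> from \<open>\<nabla>f(w')\<close> to \<open>\<nabla>f(w)\<close>.\<close>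

definition cut :: "('a \<Rightarrow> 'b::real_inner) \<Rightarrow> 'b \<Rightarrow> 'a \<Rightarrow> 'b \<Rightarrow> 'a \<Rightarrow> real" where
  "cut A b w q u = gradf w \<bullet> (w - u) - f w + q \<bullet> (b - A u)"

text \<open>Weak duality for a single \<open>u\<close>, from the tangent to \<open>f\<close> at
  \<open>w\<close>.\<close>

lemma cut_ge: "- f u - q \<bullet> (A u - b) \<le> cut A b w q u"
  using tangent[of w u] by (simp add: cut_def inner_simps)

text \<open>Converts a drop \<open>d\<close> of one cut into a lower bound for the step length. The
  drop is at most linear in the differences of the gradients and of \<open>q\<close>, and
  \<open>bregman_cocoercive\<close> controls the former; the constants also use
  \<open>norm (w - u) \<le> 2 * R\<close>.\<close>

lemma cut_decrease:
  assumes "norm w \<le> R" "norm u \<le> R" "norm (b - A u) \<le> G"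
    and d: "0 \<le> d" "d \<le> cut A b w q u - cut A b w' q' u"
  shows "d\<^sup>2 \<le> (32 * \<beta> * R\<^sup>2 + 4 * G\<^sup>2) * (bregman w' w + (norm (q' - q))\<^sup>2 / 2)"
proof -
  let ?X = "norm (gradf w - gradf w')" and ?Y = "norm (q - q')"
  have R: "0 \<le> R" and G: "0 \<le> G" using assms norm_ge_zero order_trans by blast+
  have "d \<le> (gradf w - gradf w') \<bullet> (w - u) + (q - q') \<bullet> (b - A u)"
    using d(2) tangent[of w' w] by (simp add: cut_def inner_simps)
  also have "\<dots> \<le> ?X * norm (w - u) + ?Y * norm (b - A u)"
    by (intro add_mono norm_cauchy_schwarz)
  also have "\<dots> \<le> ?X * (2 * R) + ?Y * G"
    using assms norm_triangle_ineq4[of w u] by (intro add_mono mult_left_mono) auto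
  finally have "d\<^sup>2 \<le> (?X * (2 * R) + ?Y * G)\<^sup>2" using d(1) by (rule power_mono)
  also have "\<dots> \<le> 2 * (?X * (2 * R))\<^sup>2 + 2 * (?Y * G)\<^sup>2"
    using sum_squares_bound[of "?X * (2 * R)" "?Y * G"] by (simp add: power2_sum)
  also have "\<dots> = 8 * R\<^sup>2 * ?X\<^sup>2 + 2 * G\<^sup>2 * ?Y\<^sup>2" by (simp add: power_mult_distrib)
  also have "\<dots> \<le> 8 * R\<^sup>2 * (4 * \<beta> * bregman w' w) + 2 * G\<^sup>2 * ?Y\<^sup>2"
    using bregman_cocoercive[of w' w] f_smooth(1)
    by (intro add_right_mono mult_left_mono) (auto simp: norm_minus_commute field_simps)
  also have "\<dots> \<le> (32 * \<beta> * R\<^sup>2 + 4 * G\<^sup>2) * (bregman w' w + ?Y\<^sup>2 / 2)"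
  proof -
    have "0 \<le> 4 * G\<^sup>2 * bregman w' w" "0 \<le> 32 * \<beta> * R\<^sup>2 * (?Y\<^sup>2 / 2)"
      using bregman_nonneg f_smooth(1) by simp_all
    then show ?thesis by (simp add: algebra_simps)
  qed
  finally show ?thesis by (simp add: norm_minus_commute)
qed

text \<open>Dividing by the scale gives \<open>w\<close> plus a multiple of
  \<open>a - c *\<^sub>R w\<close>, so smoothness of \<open>f\<close> applies. A scale of at least 1
  lets the division of the quadratic term be dropped.\<close>

lemma perspective_quadratic_upper:
  assumes "1 \<le> \<sigma> + h * c" "\<sigma> \<noteq> 0"
  shows "perspective f (\<sigma> *\<^sub>R w + h *\<^sub>R a) (\<sigma> + h * c)
    \<le> \<sigma> * f w + h * (c * f w + gradf w \<bullet> (a - c *\<^sub>R w)) + h\<^sup>2 * (\<beta> * (norm (a - c *\<^sub>R w))\<^sup>2)"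
proof -
  define s where "s = \<sigma> + h * c"
  define d where "d = a - c *\<^sub>R w"
  have s: "1 \<le> s" using assms by (simp add: s_def)
  have "\<sigma> *\<^sub>R w + h *\<^sub>R a = s *\<^sub>R w + h *\<^sub>R d" by (simp add: s_def d_def algebra_simps)
  then have "(\<sigma> *\<^sub>R w + h *\<^sub>R a) /\<^sub>R s = w + (h / s) *\<^sub>R d"
    using s by (simp add: scaleR_right_distrib divide_inverse_commute)
  then have "perspective f (\<sigma> *\<^sub>R w + h *\<^sub>R a) s = s * f (w + (h / s) *\<^sub>R d)"
    by (simp add: perspective_def)
  also have "\<dots> \<le> s * (f w + h / s * (gradf w \<bullet> d) + \<beta> * ((h / s)\<^sup>2 * (norm d)\<^sup>2))"
    using quadratic_upper[of w "(h / s) *\<^sub>R d"] s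
    by (intro mult_left_mono) (auto simp: power_mult_distrib power_divide)
  also have "\<dots> = s * f w + h * (gradf w \<bullet> d) + h\<^sup>2 * (\<beta> * (norm d)\<^sup>2) / s"
    using s by (simp add: field_simps power2_eq_square)
  also have "\<dots> \<le> s * f w + h * (gradf w \<bullet> d) + h\<^sup>2 * (\<beta> * (norm d)\<^sup>2)"
  proof -
    have "0 \<le> h\<^sup>2 * (\<beta> * (norm d)\<^sup>2)" using f_smooth(1) by simp
    then have "h\<^sup>2 * (\<beta> * (norm d)\<^sup>2) / s \<le> h\<^sup>2 * (\<beta> * (norm d)\<^sup>2)"
      using s mult_left_mono[of 1 s] by (simp add: divide_le_eq)
    then show ?thesis by simp
  qed
  finally show ?thesis by (simp add: s_def d_def algebra_simps)
qed

end

section \<open>Optimality conditions of the candidate problem\<close>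

locale dual_candidate = smooth_convex f gradf \<beta>
  for f :: "'a::{real_inner,complete_space} \<Rightarrow> real" and gradf \<beta> +
  fixes A :: "'a \<Rightarrow> 'b::{real_inner,complete_space}" and b :: 'b and Q :: "'b set"
    and w :: 'a and q :: 'b and l :: real and S :: "'a set" and \<nu> :: "'a measure"
    and e :: 'a and s :: real and w' :: 'a and q' :: 'b
  assumes A: "bounded_linear A" and Q: "closed Q" "convex Q" "Q \<noteq> {}"
    and S: "bounded S" "S \<noteq> {}"
    and arg_min: "is_arg_min (candidate_obj f A b Q w q (ereal l) S) (\<lambda>m. m \<in> radon_measures S) \<nu>"
    and e_def: "e = neg_moment \<nu>" and s_def: "s = neg_mass S \<nu>"
    and w'_def: "w' = (w - e) /\<^sub>R (1 - s)" and q'_def: "q' = metric_proj Q (q + s *\<^sub>R b - A e)"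
begin

interpretation A: bounded_linear A by (fact A)

lemma \<nu>: "\<nu> \<in> radon_measures S"
  using arg_min by (simp add: is_arg_min_def)

lemma s_nonpos: "s \<le> 0"
  by (simp add: s_def neg_mass_def)

lemma w_eq: "w - e = (1 - s) *\<^sub>R w'"
  using s_nonpos by (simp add: w'_def)

text \<open>The candidate objective sees a measure only through its moment \<open>x\<close> and mass
  \<open>n\<close>.\<close>

definition dual_obj :: "'a \<Rightarrow> real \<Rightarrow> real" where
  "dual_obj x n = perspective f (- x + w) (1 - n) + proj_potential Q (- A x + n *\<^sub>R b + q) - l * n"

lemma candidate_obj_eq:
  "candidate_obj f A b Q w q (ereal l) S m = ereal (dual_obj (neg_moment m) (neg_mass S m))"
  by (simp add: candidate_obj_def Let_def dual_obj_def proj_potential_eq_infdist[OF Q])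

lemma dual_obj_le: "m \<in> radon_measures S \<Longrightarrow> dual_obj e s \<le> dual_obj (neg_moment m) (neg_mass S m)"
  using arg_min by (auto simp: is_arg_min_def candidate_obj_eq e_def s_def not_less)

text \<open>First-order optimality at \<open>(e, s)\<close> in the direction
  \<open>- (a, c)\<close>. Two choices matter: \<open>(u, 1)\<close> adds an atom at
  \<open>u\<close>, and \<open>(e, s)\<close> shrinks \<open>\<nu>\<close>.\<close>

lemma directional_nonneg:
  assumes "\<And>h. 0 < h \<Longrightarrow> h \<le> 1 \<Longrightarrow> s - h * c \<le> 0"
    and "\<And>h. 0 < h \<Longrightarrow> h \<le> 1 \<Longrightarrow> dual_obj e s \<le> dual_obj (e - h *\<^sub>R a) (s - h * c)"
  shows "0 \<le> c * f w' + gradf w' \<bullet> (a - c *\<^sub>R w') + q' \<bullet> (A a - c *\<^sub>R b) + l * c"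
proof (rule nonneg_if_quadratic_nonneg)
  fix h :: real assume h: "0 < h" "h \<le> 1"
  have "1 \<le> (1 - s) + h * c" using assms(1)[OF h] by simp
  then have "perspective f ((1 - s) *\<^sub>R w' + h *\<^sub>R a) ((1 - s) + h * c)
    \<le> (1 - s) * f w' + h * (c * f w' + gradf w' \<bullet> (a - c *\<^sub>R w')) + h\<^sup>2 * (\<beta> * (norm (a - c *\<^sub>R w'))\<^sup>2)"
    using s_nonpos by (intro perspective_quadratic_upper) auto
  moreover have "(1 - s) *\<^sub>R w' + h *\<^sub>R a = - (e - h *\<^sub>R a) + w" "(1 - s) + h * c = 1 - (s - h * c)"
    using w_eq by (simp_all add: algebra_simps)
  moreover have "perspective f (- e + w) (1 - s) = (1 - s) * f w'"
    by (simp add: perspective_def w'_def)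
  ultimately have 1: "perspective f (- (e - h *\<^sub>R a) + w) (1 - (s - h * c))
    \<le> perspective f (- e + w) (1 - s) + h * (c * f w' + gradf w' \<bullet> (a - c *\<^sub>R w'))
      + h\<^sup>2 * (\<beta> * (norm (a - c *\<^sub>R w'))\<^sup>2)"
    by simp
  have 2: "proj_potential Q (- A (e - h *\<^sub>R a) + (s - h * c) *\<^sub>R b + q)
    \<le> proj_potential Q (- A e + s *\<^sub>R b + q) + h * (q' \<bullet> (A a - c *\<^sub>R b)) + h\<^sup>2 * (norm (A a - c *\<^sub>R b))\<^sup>2"
  proof -
    have shift: "- A (e - h *\<^sub>R a) + (s - h * c) *\<^sub>R b + q = (- A e + s *\<^sub>R b + q) + h *\<^sub>R (A a - c *\<^sub>R b)"
      by (simp add: A.diff A.scaleR algebra_simps)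
    have q': "q' = metric_proj Q (- A e + s *\<^sub>R b + q)"
      by (simp add: q'_def algebra_simps)
    have "(norm (h *\<^sub>R (A a - c *\<^sub>R b)))\<^sup>2 = h\<^sup>2 * (norm (A a - c *\<^sub>R b))\<^sup>2"
      by (simp add: power_mult_distrib)
    then show ?thesis
      using proj_potential_quadratic_upper[OF Q, of "- A e + s *\<^sub>R b + q" "h *\<^sub>R (A a - c *\<^sub>R b)"]
      unfolding shift q' inner_scaleR_right by simp
  qed
  have arith: "0 \<le> h * (G1 + G2 + l * c) + h\<^sup>2 * (N1 + N2)"
    if "P + T - l * s \<le> X + Y - l * (s - h * c)" "X \<le> P + h * G1 + h\<^sup>2 * N1" "Y \<le> T + h * G2 + h\<^sup>2 * N2"
    for P T X Y G1 G2 N1 N2 :: real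
    using that by (simp add: algebra_simps)
  show "0 \<le> h * (c * f w' + gradf w' \<bullet> (a - c *\<^sub>R w') + q' \<bullet> (A a - c *\<^sub>R b) + l * c)
      + h\<^sup>2 * (\<beta> * (norm (a - c *\<^sub>R w'))\<^sup>2 + (norm (A a - c *\<^sub>R b))\<^sup>2)"
    by (rule arith[OF assms(2)[OF h, unfolded dual_obj_def] 1 2])
qed

text \<open>When mass is added at \<open>u\<close>, the derivative of the objective is
  \<open>l\<close> minus the cut, so optimality yields feasibility.\<close>

lemma cut_le_level:
  assumes "u \<in> S"
  shows "cut A b w' q' u \<le> l"
proof -
  have "0 \<le> 1 * f w' + gradf w' \<bullet> (u - 1 *\<^sub>R w') + q' \<bullet> (A u - 1 *\<^sub>R b) + l * 1"
  proof (rule directional_nonneg)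
    fix h :: real assume h: "0 < h" "h \<le> 1"
    show "s - h * 1 \<le> 0" using s_nonpos h by simp
    have "add_point_mass 1 \<nu> h u \<in> radon_measures S"
      using assms h by (intro radon_add_point_mass \<nu>) auto
    from dual_obj_le[OF this] show "dual_obj e s \<le> dual_obj (e - h *\<^sub>R u) (s - h * 1)"
      using neg_moment_add_point_mass[OF \<nu> S(1) assms, of 1 h] h by (simp add: e_def s_def)
  qed
  then show ?thesis by (simp add: cut_def inner_simps)
qed

text \<open>The expression is the integral of cut minus \<open>l\<close> against
  \<open>\<nu>\<close>; together with \<open>cut_le_level\<close> it says that \<open>\<nu>\<close>
  charges only tight cuts. It comes from shrinking \<open>\<nu>\<close>.\<close>

lemma complementarity:
  "0 \<le> s * f w' + gradf w' \<bullet> (e - s *\<^sub>R w') + q' \<bullet> (A e - s *\<^sub>R b) + l * s"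
proof (rule directional_nonneg)
  fix h :: real assume h: "0 < h" "h \<le> 1"
  show "s - h * s \<le> 0" using s_nonpos h mult_nonpos_nonneg[of s "1 - h"] by (simp add: algebra_simps)
  obtain u where u: "u \<in> S" using S(2) by blast
  \<comment> \<open>The atom has weight 0, so any point of \<open>S\<close> serves.\<close>
  have "add_point_mass (1 - h) \<nu> 0 u \<in> radon_measures S"
    using u h by (intro radon_add_point_mass \<nu>) auto
  from dual_obj_le[OF this] show "dual_obj e s \<le> dual_obj (e - h *\<^sub>R e) (s - h * s)"
    using neg_moment_add_point_mass[OF \<nu> S(1) u, of "1 - h" 0] h
    by (simp add: e_def s_def algebra_simps)
qed

text \<open>Generalised Pythagorean inequality. The comparison point may exceed the level by
  \<open>\<epsilon>\<close>, which costs \<open>\<epsilon>\<close> times the total multiplier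
  \<open>- s\<close>.\<close>

lemma bregman_projection:
  assumes qs: "qs \<in> Q" and feasible: "\<And>u. u \<in> S \<Longrightarrow> cut A b ws qs u \<le> l + \<epsilon>"
  shows "bregman ws w' + (norm (qs - q'))\<^sup>2 / 2 + (bregman w' w + (norm (q' - q))\<^sup>2 / 2)
    \<le> bregman ws w + (norm (qs - q))\<^sup>2 / 2 + \<epsilon> * - s"
proof -
  have diff: "w' - w = s *\<^sub>R w' - e" using w_eq by (simp add: algebra_simps)
  have "bregman ws w - bregman ws w' - bregman w' w = (gradf ws - gradf w') \<bullet> (w' - w)"
    by (simp add: bregman_def inner_simps)
  then have 1: "bregman ws w - bregman ws w' - bregman w' w = (gradf ws - gradf w') \<bullet> (s *\<^sub>R w' - e)"
    by (simp add: diff)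
  have "(norm (qs - q))\<^sup>2 / 2 - (norm (qs - q'))\<^sup>2 / 2 - (norm (q' - q))\<^sup>2 / 2 = (qs - q') \<bullet> (q' - q)"
    by (simp add: power2_norm_eq_inner inner_simps inner_commute field_simps)
  moreover have "(q + s *\<^sub>R b - A e - q') \<bullet> (qs - q') \<le> 0"
    unfolding q'_def by (rule metric_proj_obtuse[OF Q(1,2) qs])
  ultimately have 2: "(norm (qs - q))\<^sup>2 / 2 - (norm (qs - q'))\<^sup>2 / 2 - (norm (q' - q))\<^sup>2 / 2
      \<ge> (qs - q') \<bullet> (s *\<^sub>R b - A e)"
    by (simp add: inner_simps inner_commute)
  \<comment> \<open>The cuts at the comparison point are affine in \<open>u\<close>, so the
    feasibility bound can be integrated against \<open>\<nu>\<close>.\<close>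
  have "- (gradf ws + adjoint A qs) \<bullet> u \<le> l + \<epsilon> - gradf ws \<bullet> ws + f ws - qs \<bullet> b" if "u \<in> S" for u
    using feasible[OF that] by (simp add: cut_def inner_simps adjoint_inner[OF A])
  from radon_moment_mono[OF \<nu> S(1) this]
  have 3: "gradf ws \<bullet> e + qs \<bullet> A e \<le> (l + \<epsilon> - gradf ws \<bullet> ws + f ws - qs \<bullet> b) * - s"
    by (simp add: inner_simps adjoint_inner[OF A] flip: e_def s_def)
  have 4: "0 \<le> - s * (f w' - f ws - gradf ws \<bullet> (w' - ws))"
    using s_nonpos tangent[of ws w'] by (intro mult_nonneg_nonneg) auto
  show ?thesis
    using 1 2 3 4 complementarity by (simp add: inner_simps algebra_simps)
qed

text \<open>\<open>w'\<close> averages \<open>w\<close>, with weight 1, and points of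
  \<open>S\<close>, with total weight \<open>- s\<close>. Testing the moment with \<open>- e\<close>
  gives \<open>norm e \<le> R * - s\<close>.\<close>

lemma norm_next_le:
  assumes "norm w \<le> R" and SR: "\<And>u. u \<in> S \<Longrightarrow> norm u \<le> R"
  shows "norm w' \<le> R"
proof -
  have "- e \<bullet> u \<le> norm e * R" if "u \<in> S" for u
    using norm_cauchy_schwarz[of "- e" u] mult_left_mono[OF SR[OF that], of "norm e"] by simp
  from radon_moment_mono[OF \<nu> S(1) this]
  have "e \<bullet> e \<le> norm e * R * - s" by (simp flip: e_def s_def)
  then have "norm e * norm e \<le> norm e * (R * - s)" by (simp add: dot_square_norm power2_eq_square mult.assoc)
  moreover have "0 \<le> R * - s" using assms(1) s_nonpos order_trans[OF norm_ge_zero] by (intro mult_nonneg_nonneg) auto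
  ultimately have "norm e \<le> R * - s"
    using mult_left_le_imp_le[of "norm e" "norm e" "R * - s"] by (cases "e = 0") auto
  then have "norm (w - e) \<le> R * (1 - s)"
    using norm_triangle_ineq4[of w e] assms(1) by (simp add: algebra_simps)
  then have "(1 - s) * norm w' \<le> (1 - s) * R"
    using s_nonpos by (simp add: w_eq mult.commute)
  then show ?thesis using s_nonpos by simp
qed

end

section \<open>Counting steps over phases\<close>

text \<open>A new phase starts whenever \<open>D t < c * thr (t - 1)\<close>, with \<open>thr\<close> the value of \<open>D\<close> at the
  last start. A phase of \<open>n\<close> steps satisfies \<open>n c\<^sup>2 thr\<^sup>2 \<le> R\<close>, and the thresholds decay
  geometrically, so the last phase dominates the count.\<close>

lemma phase_counting:
  fixes D thr :: "nat \<Rightarrow> real" and c R :: real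
  assumes c: "0 < c" "c < 1"
    and D: "\<And>t. 0 \<le> D t"
    and thr0: "thr 0 = D 0"
    and thr_Suc: "\<And>t. thr (Suc t) = (if D (Suc t) < c * thr t then D (Suc t) else thr t)"
    and phase: "\<And>p T. p \<le> T \<Longrightarrow> thr p = D p \<Longrightarrow> (\<And>t. p \<le> t \<Longrightarrow> t < T \<Longrightarrow> \<not> D (Suc t) < c * thr t) \<Longrightarrow>
      (\<Sum>t=p..T. (D t)\<^sup>2) \<le> R"
  shows "real (t + 1) * (thr t)\<^sup>2 \<le> R / (c\<^sup>2 * (1 - c\<^sup>2))"
proof -
  \<comment> \<open>Solves \<open>B = c\<^sup>2 * B + R / c\<^sup>2\<close>: the charge for all
    earlier phases plus that of the current one.\<close>
  define B where "B = R / (c\<^sup>2 * (1 - c\<^sup>2))"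
  have c2: "0 < c\<^sup>2" "c\<^sup>2 < 1" using c by (auto simp: power_less_one_iff)
  have "a * (R / (a * (1 - a))) + R / a = R / (a * (1 - a))" if "0 < a" "a < 1" for a :: real
    using that by (simp add: divide_simps) (simp add: algebra_simps)
  then have BR: "c\<^sup>2 * B + R / c\<^sup>2 = B" using c2 by (simp add: B_def)
  have thr_nonneg: "0 \<le> thr t" for t by (induction t) (auto simp: thr0 thr_Suc D)
  have len: "real (T - p + 1) * (thr T)\<^sup>2 \<le> R / c\<^sup>2"
    if p: "p \<le> T" "thr p = D p" and np: "\<And>t. p \<le> t \<Longrightarrow> t < T \<Longrightarrow> \<not> D (Suc t) < c * thr t" for p T
  proof -
    have thr: "thr t = thr p" if "p \<le> t" "t \<le> T" for t
      using that
    proof (induction t rule: dec_induct)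
      case (step t) then show ?case using np[of t] by (simp add: thr_Suc)
    qed simp
    have "c * thr p \<le> D t" if t: "p \<le> t" "t \<le> T" for t
    proof (cases "t = p")
      case True
      then show ?thesis using p(2) c D[of p] mult_right_mono[of c 1 "D p"] by simp
    next
      case False
      then obtain s where s: "t = Suc s" "p \<le> s" "s < T" using t by (cases t) auto
      then show ?thesis using np[of s] thr[of s] by simp
    qed
    then have "(c * thr p)\<^sup>2 \<le> (D t)\<^sup>2" if "t \<in> {p..T}" for t
      using that c thr_nonneg by (intro power_mono) auto
    then have "(\<Sum>t=p..T. (c * thr p)\<^sup>2) \<le> (\<Sum>t=p..T. (D t)\<^sup>2)" by (rule sum_mono)
    also have "\<dots> \<le> R" using phase[OF that] by blast
    finally have "real (T - p + 1) * (c\<^sup>2 * (thr T)\<^sup>2) \<le> R"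
      using p(1) thr[of T] by (simp add: power_mult_distrib Suc_diff_le)
    then show ?thesis using c2 by (simp add: field_simps)
  qed
  \<comment> \<open>\<open>p\<close> is the start of the phase of \<open>t\<close>. Earlier steps
    are charged \<open>c\<^sup>2 * B\<close>, because a restart lowers the threshold by a factor
    below \<open>c\<close> when the count is at most \<open>B\<close>.\<close>
  have "\<exists>p\<le>t. thr p = D p \<and> (\<forall>s. p \<le> s \<longrightarrow> s < t \<longrightarrow> \<not> D (Suc s) < c * thr s) \<and> real p * (thr p)\<^sup>2 \<le> c\<^sup>2 * B"
  proof (induction t)
    case 0
    have "0 \<le> R" using len[of 0 0] thr0 c2 by (smt (verit) divide_nonneg_pos zero_le_mult_iff D phase sum_nonneg zero_le_power2 le_refl less_zeroE)
    then have "0 \<le> B" using c2 by (simp add: B_def)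
    then show ?case using thr0 c2 by auto
  next
    case (Suc t)
    then obtain p where p: "p \<le> t" "thr p = D p" "\<And>s. p \<le> s \<Longrightarrow> s < t \<Longrightarrow> \<not> D (Suc s) < c * thr s"
      "real p * (thr p)\<^sup>2 \<le> c\<^sup>2 * B" by blast
    show ?case
    proof (cases "D (Suc t) < c * thr t")
      case False
      then show ?thesis using p by (intro exI[of _ p]) (auto simp: less_Suc_eq)
    next
      case True
      have thr: "thr t = thr p"
        using p(1) 
      proof (induction t rule: dec_induct)
        case (step s) then show ?case using p(3)[of s] by (simp add: thr_Suc)
      qed simp
      have "real (t + 1) * (thr t)\<^sup>2 = real p * (thr p)\<^sup>2 + real (t - p + 1) * (thr t)\<^sup>2"
        using p(1) thr by (simp add: of_nat_diff algebra_simps)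
      also have "\<dots> \<le> c\<^sup>2 * B + R / c\<^sup>2" using p(4) len[OF p(1-3)] by linarith
      finally have le: "real (t + 1) * (thr t)\<^sup>2 \<le> B" using BR by simp
      have "(thr (Suc t))\<^sup>2 \<le> (c * thr t)\<^sup>2"
        using True D by (intro power_mono) (auto simp: thr_Suc)
      then have "real (t + 1) * (thr (Suc t))\<^sup>2 \<le> c\<^sup>2 * (real (t + 1) * (thr t)\<^sup>2)"
        using mult_left_mono[of "(thr (Suc t))\<^sup>2" "(c * thr t)\<^sup>2" "real (t + 1)"]
        by (simp add: power_mult_distrib algebra_simps)
      also have "\<dots> \<le> c\<^sup>2 * B" using le by (rule mult_left_mono) simp
      finally have "real (Suc t) * (thr (Suc t))\<^sup>2 \<le> c\<^sup>2 * B" by simp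
      then show ?thesis using True by (intro exI[of _ "Suc t"]) (auto simp: thr_Suc)
    qed
  qed
  then obtain p where p: "p \<le> t" "thr p = D p" "\<And>s. p \<le> s \<Longrightarrow> s < t \<Longrightarrow> \<not> D (Suc s) < c * thr s"
    "real p * (thr p)\<^sup>2 \<le> c\<^sup>2 * B" by blast
  have thr: "thr t = thr p"
    using p(1) p(3)
  proof (induction t rule: dec_induct)
    case (step s) then show ?case using step.prems[of s] by (simp add: thr_Suc)
  qed simp
  have "real (t + 1) * (thr t)\<^sup>2 = real p * (thr p)\<^sup>2 + real (t - p + 1) * (thr t)\<^sup>2"
    using p(1) thr by (simp add: of_nat_diff algebra_simps)
  also have "\<dots> \<le> c\<^sup>2 * B + R / c\<^sup>2" using p(4) len[OF p(1-3)] by linarith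
  finally show ?thesis using BR by (simp add: B_def)
qed

section \<open>Runs of the method\<close>

lemma closed_closed_hull: "closed (closed_hull S)"
  by (simp add: closed_hull_def)

lemma convex_closed_hull: "convex (closed_hull S)"
  by (simp add: closed_hull_def convex_convex_hull)

lemma subset_closed_hull: "S \<subseteq> closed_hull S"
  unfolding closed_hull_def using hull_subset closure_subset by (rule subset_trans)

lemma closed_hull_minimal: "S \<subseteq> T \<Longrightarrow> closed T \<Longrightarrow> convex T \<Longrightarrow> closed_hull S \<subseteq> T"
  unfolding closed_hull_def by (intro closure_minimal hull_minimal)

lemma closed_hull_mono: "S \<subseteq> T \<Longrightarrow> closed_hull S \<subseteq> closed_hull T"
  by (meson closed_hull_minimal closed_closed_hull convex_closed_hull subset_closed_hull subset_trans)

lemma prev_simps [simp]: "prev x X 0 = x" "prev x X (Suc t) = X t"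
  by (simp_all add: prev_def)

lemma support_fun_le: "(\<And>q. q \<in> Q \<Longrightarrow> q \<bullet> z \<le> r) \<Longrightarrow> support_fun Q z \<le> ereal r"
  unfolding support_fun_def inner_commute[of z] by (rule SUP_least) simp

lemma support_fun_ge: "q \<in> Q \<Longrightarrow> ereal (q \<bullet> z) \<le> support_fun Q z"
  unfolding support_fun_def inner_commute[of q z] by (rule SUP_upper)

lemma (in smooth_convex) conjugate_gradient: "conjugate f (gradf x) = ereal (gradf x \<bullet> x - f x)"
  unfolding conjugate_def
proof (rule antisym)
  show "(SUP y. ereal (gradf x \<bullet> y - f y)) \<le> ereal (gradf x \<bullet> x - f x)"
  proof (rule SUP_least)
    fix y show "ereal (gradf x \<bullet> y - f y) \<le> ereal (gradf x \<bullet> x - f x)"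
      using tangent[of x y] by (simp add: inner_simps)
  qed
qed (rule SUP_upper, simp)

text \<open>Testing the subgradient inequality at \<open>gradf x\<close> gives equality in
  Fenchel-Young, so \<open>s\<close> is a subgradient of \<open>f\<close> at \<open>x\<close>; the
  quadratic upper bound then forces \<open>s = gradf x\<close>.\<close>

lemma (in smooth_convex) subdiff_conjugate_imp_gradient:
  assumes "x \<in> subdiff (conjugate f) s"
  shows "s = gradf x"
proof -
  have ge: "conjugate f y \<ge> conjugate f s + ereal (x \<bullet> (y - s))" for y
    using assms by (simp add: subdiff_def)
  have "\<bar>conjugate f s\<bar> \<noteq> \<infinity>" using assms by (simp add: subdiff_def eff_dom_def)
  then obtain c where c: "conjugate f s = ereal c" by auto
  have "c + x \<bullet> (gradf x - s) \<le> gradf x \<bullet> x - f x"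
    using ge[of "gradf x"] by (simp add: c conjugate_gradient)
  moreover have "s \<bullet> y - f y \<le> c" for y
  proof -
    have "ereal (s \<bullet> y - f y) \<le> conjugate f s" unfolding conjugate_def by (rule SUP_upper) simp
    then show ?thesis by (simp add: c)
  qed
  ultimately have sub: "f x + s \<bullet> (y - x) \<le> f y" for y
    by (smt (verit) inner_commute inner_diff_right)
  define d where "d = s - gradf x"
  have "0 \<le> - (d \<bullet> d)"
  proof (rule nonneg_if_quadratic_nonneg)
    fix h :: real
    have "f x + s \<bullet> (h *\<^sub>R d) \<le> f x + gradf x \<bullet> (h *\<^sub>R d) + \<beta> * (norm (h *\<^sub>R d))\<^sup>2"
      using sub[of "x + h *\<^sub>R d"] quadratic_upper[of x "h *\<^sub>R d"] by simp
    then have "h * ((s - gradf x) \<bullet> d) \<le> h\<^sup>2 * (\<beta> * (norm d)\<^sup>2)"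
      by (simp add: inner_diff_left power_mult_distrib algebra_simps)
    then show "0 \<le> h * - (d \<bullet> d) + h\<^sup>2 * (\<beta> * (norm d)\<^sup>2)"
      by (simp add: d_def)
  qed
  then have "d \<bullet> d = 0" using inner_ge_zero[of d] by linarith
  then show ?thesis by (simp add: d_def)
qed

locale dls_run = smooth_convex f gradf \<beta>
  for f :: "'a::{real_inner,complete_space} \<Rightarrow> real" and gradf \<beta> +
  fixes A :: "'a \<Rightarrow> 'b::{real_inner,complete_space}" and b :: 'b and Q Q1 Q2 :: "'b set"
    and K Kinit :: "'a set" and lam Coracle :: real
    and \<mu>0 :: "'a \<times> 'b"
    and \<mu> \<mu>hat xhat :: "nat \<Rightarrow> 'a \<times> 'b"
    and w v :: "nat \<Rightarrow> 'a"
    and hbar hlow \<Delta> lev Dbar :: "nat \<Rightarrow> ereal"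
    and Ks :: "nat \<Rightarrow> 'a set"
    and \<nu> :: "nat \<Rightarrow> 'a measure"
  assumes Q_ne: "Q \<noteq> {}" and Q_eq: "Q = {q1 + q2 | q1 q2. q1 \<in> Q1 \<and> q2 \<in> Q2}"
    and Q1: "closed Q1" "convex Q1" "bounded Q1"
    and Q2: "closed Q2" "convex Q2" "cone Q2"
    and K: "closed K" "convex K"
    and A: "bounded_linear A"
    and \<mu>0: "snd \<mu>0 \<in> Q"
    and Kinit: "compact Kinit" "Kinit \<subseteq> K"
      "- b \<in> interior {p - A x | p x. p \<in> polar_cone Q2 \<and> x \<in> closed_hull Kinit}"
    and lam: "0 < lam" "lam < 1"
    and dls: "dls_method f gradf A b Q K Kinit \<mu>0 lam
                \<mu> w v hbar \<mu>hat xhat hlow \<Delta> lev Dbar Ks \<nu>"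
    and oracle_bound: "\<And>t. norm (v t, A (v t)) \<le> Coracle"
begin

interpretation A: bounded_linear A by (fact A)

abbreviation "q t \<equiv> snd (\<mu> t)"
abbreviation "x1 t \<equiv> fst (xhat t)"
abbreviation "acut \<equiv> cut A b"

definition "Kt t = closed_hull (prev Kinit Ks t \<union> {- v t})"

lemma dls_init: "\<mu> 0 = \<mu>0" "w 0 \<in> subdiff (conjugate f) (fst \<mu>0)"
  using dls by (simp_all add: dls_method_def)

lemma
  shows dls_oracle: "is_arg_min (\<lambda>u. (fst (\<mu> t) + adjoint A (q t)) \<bullet> u) (\<lambda>u. u \<in> K) (- v t)"
    and dls_hbar: "hbar t = min (prev \<infinity> hbar t)
         (ereal (q t \<bullet> b + fst (\<mu> t) \<bullet> w t + (fst (\<mu> t) + adjoint A (q t)) \<bullet> v t - f (w t)))"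
    and dls_muhat: "\<mu>hat t = (if hbar t < prev \<infinity> hbar t then \<mu> t else prev \<mu>0 \<mu>hat t)"
    and dls_xhat: "is_arg_min (\<lambda>x. ereal (f (fst x)) + support_fun Q (snd x - b))
         (\<lambda>x. fst x \<in> Kt t \<and> snd x = A (fst x)) (xhat t)"
    and dls_hlow: "hlow t = - ereal (f (x1 t)) - support_fun Q (A (x1 t) - b)"
    and dls_gap: "\<Delta> t = hbar t - hlow t"
    and dls_lev: "lev t = ereal lam * hbar t + ereal (1 - lam) * hlow t"
    and dls_prune: "if \<Delta> t < ereal (1 - lam) * prev \<infinity> Dbar t
        then simple_set Kinit (Ks t) \<and> Ks t \<subseteq> Kt t \<and> x1 t \<in> closed_hull (Ks t) \<and> Dbar t = \<Delta> t
        else Ks t = prev Kinit Ks t \<union> {- v t} \<and> Dbar t = prev \<infinity> Dbar t"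
    and dls_candidate: "is_arg_min (candidate_obj f A b Q (w t) (q t) (lev t) (Ks t))
         (\<lambda>m. m \<in> radon_measures (Ks t)) (\<nu> t)"
    and dls_w: "w (Suc t) = (w t - neg_moment (\<nu> t)) /\<^sub>R (1 - neg_mass (Ks t) (\<nu> t))"
    and dls_mu: "\<mu> (Suc t) = (gradf (w (Suc t)),
         metric_proj Q (q t + neg_mass (Ks t) (\<nu> t) *\<^sub>R b - A (neg_moment (\<nu> t))))"
  using dls unfolding dls_method_def Let_def Kt_def by blast+

lemma Q_closed_convex: "closed Q" "convex Q"
proof -
  show "closed Q" unfolding Q_eq by (intro closed_convex_bounded_sum Q1 Q2)
  have "Q = (\<Union>x\<in>Q1. \<Union>y\<in>Q2. {x + y})" unfolding Q_eq by blast
  then show "convex Q" using convex_sums[OF Q1(2) Q2(2)] by simp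
qed

lemma q_in_Q: "q t \<in> Q"
  using \<mu>0 dls_init(1) metric_proj_in[OF Q_closed_convex Q_ne] dls_mu by (cases t) auto

lemma fst_mu: "fst (\<mu> t) = gradf (w t)"
  using subdiff_conjugate_imp_gradient[OF dls_init(2)] dls_init(1) dls_mu by (cases t) auto

lemma snd_xhat: "snd (xhat t) = A (x1 t)"
  using dls_xhat by (simp add: is_arg_min_def)

lemma neg_v_in_K: "- v t \<in> K"
  using dls_oracle by (simp add: is_arg_min_def)

lemma Ks_subset_Kt: "Ks t \<subseteq> Kt t"
  using dls_prune[of t] subset_closed_hull by (auto simp: Kt_def split: if_splits)

lemma xhat_in_hull: "x1 t \<in> closed_hull (Ks t)"
proof (cases "\<Delta> t < ereal (1 - lam) * prev \<infinity> Dbar t")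
  case False
  then have "Kt t = closed_hull (Ks t)" using dls_prune[of t] by (simp add: Kt_def)
  then show ?thesis using dls_xhat[of t] by (simp add: is_arg_min_def)
qed (use dls_prune[of t] in simp)

lemma Kinit_subset_Ks: "Kinit \<subseteq> Ks t"
proof (induction t)
  case 0 then show ?case using dls_prune[of 0] by (auto simp: simple_set_def split: if_splits)
next
  case (Suc t) then show ?case using dls_prune[of "Suc t"] by (auto simp: simple_set_def split: if_splits)
qed

text \<open>Pruning may introduce new points, but only from the closed hull of earlier ones. Applied
  to \<open>K\<close> and to a ball.\<close>

lemma Ks_subset:
  assumes "Kinit \<subseteq> T" "closed T" "convex T" "\<And>t. - v t \<in> T"
  shows "Ks t \<subseteq> T"
proof (induction t)
  case 0
  have "Kt 0 \<subseteq> T" unfolding Kt_def using assms by (intro closed_hull_minimal) auto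
  then show ?case using Ks_subset_Kt by blast
next
  case (Suc t)
  have "Kt (Suc t) \<subseteq> T" unfolding Kt_def using assms Suc by (intro closed_hull_minimal) auto
  then show ?case using Ks_subset_Kt by blast
qed

lemma xhat_in_K: "x1 t \<in> K"
  using xhat_in_hull closed_hull_minimal[OF Ks_subset[OF Kinit(2) K neg_v_in_K] K] by blast

lemma hull_Ks_subset_Kt: "closed_hull (Ks t) \<subseteq> Kt t"
  using Ks_subset_Kt by (intro closed_hull_minimal) (simp_all add: Kt_def closed_closed_hull convex_closed_hull)

text \<open>On the polar cone \<open>Q2\<close> contributes nothing positive and \<open>Q1\<close>
  at most its radius, so the support function of \<open>Q\<close> is finite there.\<close>

lemma polar_bound:
  "\<exists>M\<ge>0. \<forall>q\<in>Q. \<forall>p\<in>polar_cone Q2. q \<bullet> p \<le> M * norm p"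
proof -
  obtain M where M: "\<And>x. x \<in> Q1 \<Longrightarrow> norm x \<le> M" using Q1(3) by (auto simp: bounded_iff)
  have "q \<bullet> p \<le> \<bar>M\<bar> * norm p" if qQ: "q \<in> Q" and p: "p \<in> polar_cone Q2" for q p
  proof -
    obtain q1 q2 where q: "q = q1 + q2" "q1 \<in> Q1" "q2 \<in> Q2" using qQ Q_eq by auto
    have "q1 \<bullet> p \<le> \<bar>M\<bar> * norm p"
      using norm_cauchy_schwarz[of q1 p] mult_right_mono[of "norm q1" "\<bar>M\<bar>" "norm p"] M[OF q(2)] by force
    moreover have "q2 \<bullet> p \<le> 0" using p q(3) by (simp add: polar_cone_def)
    ultimately show ?thesis by (simp add: q inner_add_left)
  qed
  then show ?thesis by (intro exI[of _ "\<bar>M\<bar>"]) simp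
qed

lemma support_xhat_le:
  assumes "x \<in> Kt t"
  shows "ereal (f (x1 t)) + support_fun Q (A (x1 t) - b) \<le> ereal (f x) + support_fun Q (A x - b)"
proof -
  have "fst (x, A x) \<in> Kt t \<and> snd (x, A x) = A (fst (x, A x))" using assms by simp
  then have "\<not> ereal (f (fst (x, A x))) + support_fun Q (snd (x, A x) - b)
      < ereal (f (x1 t)) + support_fun Q (snd (xhat t) - b)"
    using dls_xhat[of t] unfolding is_arg_min_def by blast
  then show ?thesis by (simp add: snd_xhat not_less)
qed

section \<open>Real-valued bounds and the gap\<close>

definition "hl t = - f (x1 t) - real_of_ereal (support_fun Q (A (x1 t) - b))"

text \<open>The condition on \<open>- b\<close> yields \<open>x\<close> in the hull of
  \<open>Kinit\<close> with \<open>A x - b\<close> in the polar cone, where the support function is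
  finite; minimality of \<open>x1 t\<close> transfers this.\<close>

lemma support_xhat: "support_fun Q (A (x1 t) - b) = ereal (- hl t - f (x1 t))"
proof -
  obtain x p where "p \<in> polar_cone Q2" and x: "x \<in> closed_hull Kinit" and "- b = p - A x"
    using Kinit(3) interior_subset by blast
  then have p: "A x - b \<in> polar_cone Q2" by (simp add: algebra_simps)
  obtain M where "\<forall>q\<in>Q. \<forall>p\<in>polar_cone Q2. q \<bullet> p \<le> M * norm p" using polar_bound by blast
  with p have "support_fun Q (A x - b) \<le> ereal (M * norm (A x - b))"
    by (intro support_fun_le) simp
  moreover have "x \<in> Kt t"
    using x closed_hull_mono[OF Kinit_subset_Ks] hull_Ks_subset_Kt by blast
  ultimately have "support_fun Q (A (x1 t) - b) \<noteq> \<infinity>"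
    using support_xhat_le[of x t] by (cases "support_fun Q (A x - b)") auto
  moreover have "support_fun Q (A (x1 t) - b) \<noteq> - \<infinity>"
    using Q_ne support_fun_ge[of _ Q "A (x1 t) - b"] by (metis MInfty_neq_ereal(1) ereal_infty_less_eq(2) ex_in_conv)
  ultimately show ?thesis by (cases "support_fun Q (A (x1 t) - b)") (auto simp: hl_def)
qed

lemma hlow_eq: "hlow t = ereal (hl t)"
  by (simp add: dls_hlow support_xhat)

lemma hl_support: "p \<in> Q \<Longrightarrow> f (x1 t) + p \<bullet> (A (x1 t) - b) \<le> - hl t"
  using support_fun_ge[of p Q "A (x1 t) - b"] by (simp add: support_xhat)

lemma hl_minimal:
  assumes "x \<in> Kt t" "\<And>p. p \<in> Q \<Longrightarrow> p \<bullet> (A x - b) \<le> r"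
  shows "- hl t \<le> f x + r"
proof -
  have "ereal (- hl t) \<le> ereal (f x) + support_fun Q (A x - b)"
    using support_xhat_le[OF assms(1)] by (simp add: support_xhat)
  also have "\<dots> \<le> ereal (f x) + ereal r" using assms(2) by (intro add_left_mono support_fun_le)
  finally show ?thesis by simp
qed

lemma hl_le_cut: "p \<in> Q \<Longrightarrow> hl t \<le> acut y p (x1 t)"
  using hl_support[of p t] cut_ge[of "x1 t" p A b y] by linarith

text \<open>Pruning keeps \<open>x1 t\<close> in the closed hull, so it is still admissible one
  iteration later.\<close>

lemma hl_Suc: "hl t \<le> hl (Suc t)"
proof -
  have "closed_hull (Ks t) \<subseteq> Kt (Suc t)" unfolding Kt_def by (intro closed_hull_mono) auto
  then have "x1 t \<in> Kt (Suc t)" using xhat_in_hull by blast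
  then have "- hl (Suc t) \<le> f (x1 t) + (- hl t - f (x1 t))"
    using hl_support[of _ t] by (intro hl_minimal) (auto simp: algebra_simps)
  then show ?thesis by simp
qed

text \<open>The dual objective at \<open>\<mu> t\<close>: the oracle point maximises the cut over
  \<open>K\<close>, see \<open>cut_le_hv\<close>.\<close>

definition "hv t = acut (w t) (q t) (- v t)"

lemma hv_eq: "hv t = q t \<bullet> b + fst (\<mu> t) \<bullet> w t + (fst (\<mu> t) + adjoint A (q t)) \<bullet> v t - f (w t)"
  by (simp add: hv_def cut_def fst_mu inner_simps adjoint_inner[OF A] A.neg)

lemma cut_le_hv:
  assumes "x \<in> K"
  shows "acut (w t) (q t) x \<le> hv t"
proof -
  have "(fst (\<mu> t) + adjoint A (q t)) \<bullet> (- v t) \<le> (fst (\<mu> t) + adjoint A (q t)) \<bullet> x"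
    using dls_oracle[of t] assms by (auto simp: is_arg_min_def not_less)
  then show ?thesis
    by (simp add: hv_def cut_def fst_mu inner_simps adjoint_inner[OF A] A.neg)
qed

primrec hb :: "nat \<Rightarrow> real" where
  hb_0: "hb 0 = hv 0"
| hb_Suc: "hb (Suc t) = min (hb t) (hv (Suc t))"

lemma hbar_eq: "hbar t = ereal (hb t)"
proof (induction t)
  case 0 then show ?case using dls_hbar[of 0] by (simp add: hv_eq)
next
  case (Suc t) then show ?case using dls_hbar[of "Suc t"] by (simp add: hv_eq min_def)
qed

lemma hb_le_hv: "hb t \<le> hv t"
  by (cases t) simp_all

lemma muhat_eq: "\<exists>s\<le>t. \<mu>hat t = \<mu> s \<and> hb t = hv s"
proof (induction t)
  case 0
  then show ?case using dls_muhat[of 0] by (simp add: hbar_eq)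
next
  case (Suc t)
  show ?case
  proof (cases "hb (Suc t) < hb t")
    case True
    then show ?thesis using dls_muhat[of "Suc t"] by (intro exI[of _ "Suc t"]) (auto simp: hbar_eq)
  next
    case False
    then have "hb (Suc t) = hb t" by simp
    then show ?thesis using Suc dls_muhat[of "Suc t"] by (auto simp: hbar_eq intro: le_SucI)
  qed
qed

definition "D t = hb t - hl t"

lemma gap_eq: "\<Delta> t = ereal (D t)"
  by (simp add: dls_gap hbar_eq hlow_eq D_def)

lemma hl_le_hv: "hl s \<le> hv t"
  using hl_le_cut[OF q_in_Q] cut_le_hv[OF xhat_in_K] order_trans by blast

lemma hl_le_hb: "hl s \<le> hb t"
  using muhat_eq[of t] hl_le_hv by auto

lemma D_nonneg: "0 \<le> D t"
  using hl_le_hb by (simp add: D_def)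

lemma hb_antimono: "s \<le> t \<Longrightarrow> hb t \<le> hb s"
  by (rule lift_Suc_antimono_le) simp_all

lemma D_antimono: "s \<le> t \<Longrightarrow> D t \<le> D s"
  by (rule lift_Suc_antimono_le) (use hl_Suc in \<open>auto simp: D_def intro: diff_mono\<close>)

definition "l t = lam * hb t + (1 - lam) * hl t"

lemma lev_eq: "lev t = ereal (l t)"
  by (simp add: dls_lev hbar_eq hlow_eq l_def)

lemma l_eq: "l t = hb t - (1 - lam) * D t"
  by (simp add: l_def D_def algebra_simps)

lemma l_le_hb0: "l t \<le> hb 0"
proof -
  have "0 \<le> (1 - lam) * D t" using lam D_nonneg[of t] by simp
  then show ?thesis using hb_antimono[of 0 t] unfolding l_eq by linarith
qed

primrec thr :: "nat \<Rightarrow> real" where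
  "thr 0 = D 0"
| "thr (Suc t) = (if D (Suc t) < (1 - lam) * thr t then D (Suc t) else thr t)"

lemma Dbar_eq: "Dbar t = ereal (thr t)"
proof (induction t)
  \<comment> \<open>The initial threshold is infinite, so iteration 0 always prunes.\<close>
  case 0 then show ?case using dls_prune[of 0] lam by (simp add: gap_eq)
next
  case (Suc t) then show ?case using dls_prune[of "Suc t"] by (auto simp: gap_eq split: if_splits)
qed

lemma Ks_Suc: "\<not> D (Suc t) < (1 - lam) * thr t \<Longrightarrow> Ks (Suc t) = Ks t \<union> {- v (Suc t)}"
  using dls_prune[of "Suc t"] by (simp add: gap_eq Dbar_eq)

section \<open>Uniform bounds along a run\<close>

lemma Kinit_ne: "Kinit \<noteq> {}"
proof -
  obtain x where "x \<in> closed_hull Kinit" using Kinit(3) interior_subset by blast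
  then show ?thesis by (auto simp: closed_hull_def)
qed

lemma Ks_bounded_by:
  "\<exists>R. (\<forall>t. Ks t \<subseteq> cball 0 R) \<and> (\<forall>t. norm (v t) \<le> R) \<and> norm (w 0) \<le> R"
proof -
  obtain R0 where R0: "\<And>x. x \<in> Kinit \<Longrightarrow> norm x \<le> R0"
    using compact_imp_bounded[OF Kinit(1)] by (auto simp: bounded_iff)
  define R where "R = max R0 (max Coracle (norm (w 0)))"
  have v: "norm (v t) \<le> R" for t
    using norm_fst_le[of "v t" "A (v t)"] oracle_bound[of t] by (auto simp: R_def)
  have "Ks t \<subseteq> cball 0 R" for t
  proof (rule Ks_subset)
    show "Kinit \<subseteq> cball 0 R" using R0 by (force simp: R_def)
  qed (use v in auto)
  then show ?thesis using v by (intro exI[of _ R]) (auto simp: R_def)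
qed

lemma dual_candidate_step:
  "dual_candidate f gradf \<beta> A b Q (w t) (q t) (l t) (Ks t) (\<nu> t)
     (neg_moment (\<nu> t)) (neg_mass (Ks t) (\<nu> t)) (w (Suc t)) (q (Suc t))"
proof
  obtain R where "Ks t \<subseteq> cball 0 R" using Ks_bounded_by by blast
  then show "bounded (Ks t)" using bounded_cball bounded_subset by blast
  show "Ks t \<noteq> {}" using Kinit_ne Kinit_subset_Ks by blast
qed (use dls_candidate[of t] dls_w dls_mu in
  \<open>simp_all add: A Q_closed_convex Q_ne lev_eq\<close>)

text \<open>A cut is affine in \<open>u\<close>, so its sublevel sets are closed
  half-spaces.\<close>

lemma cut_le_on_hull:
  assumes "\<And>u. u \<in> S \<Longrightarrow> acut y p u \<le> c" "u \<in> closed_hull S"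
  shows "acut y p u \<le> c"
proof -
  have "closed_hull S \<subseteq> {u. (- gradf y - adjoint A p) \<bullet> u \<le> c - gradf y \<bullet> y + f y - p \<bullet> b}"
    using assms(1)
    by (intro closed_hull_minimal closed_halfspace_le convex_halfspace_le)
      (auto simp: cut_def inner_simps adjoint_inner[OF A] algebra_simps)
  then show ?thesis
    using assms(2) by (auto simp: cut_def inner_simps adjoint_inner[OF A] algebra_simps)
qed

text \<open>Coercivity in the second dual variable. Moving \<open>- b\<close> by \<open>d\<close> of
  length at most \<open>a\<close> along \<open>p\<close> yields \<open>u\<close> with
  \<open>A u - b + d\<close> in the polar cone; then \<open>p \<bullet> d = a * norm p\<close> is
  bounded through the cut at \<open>u\<close>.\<close>

lemma slater_bound:
  "\<exists>a>0. \<exists>c. \<forall>y p M. p \<in> Q \<longrightarrow> (\<forall>u\<in>closed_hull Kinit. acut y p u \<le> M) \<longrightarrow> a * norm p \<le> M + c"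
proof -
  obtain a where a: "a > 0"
    and sub: "cball (- b) a \<subseteq> {p - A x | p x. p \<in> polar_cone Q2 \<and> x \<in> closed_hull Kinit}"
    using Kinit(3) by (auto simp: mem_interior_cball)
  obtain M1 where M1: "\<forall>q\<in>Q. \<forall>p\<in>polar_cone Q2. q \<bullet> p \<le> M1 * norm p" "0 \<le> M1"
    using polar_bound by blast
  obtain R where R: "Ks 0 \<subseteq> cball 0 R" using Ks_bounded_by by blast
  have hR: "norm u \<le> R" if "u \<in> closed_hull Kinit" for u
    using closed_hull_minimal[OF order_trans[OF Kinit_subset_Ks R] closed_cball convex_cball] that
    by (auto simp: subset_iff)
  define F where "F = f 0 + norm (gradf 0) * R + \<beta> * R\<^sup>2"
  obtain kA where kA: "\<And>x. norm (A x) \<le> norm x * kA" "0 \<le> kA"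
    using A.nonneg_bounded by blast
  define c where "c = F + M1 * (R * kA + norm b + a)"
  have "a * norm p \<le> M + c" if p: "p \<in> Q" and M: "\<forall>u\<in>closed_hull Kinit. acut y p u \<le> M" for y p M
  proof -
    \<comment> \<open>For \<open>p = 0\<close> division by 0 gives \<open>d = 0\<close>, consistent
      with both facts below.\<close>
    define d where "d = (a / norm p) *\<^sub>R p"
    have d: "norm d \<le> a" "p \<bullet> d = a * norm p"
      using a by (auto simp: d_def dot_square_norm power2_eq_square)
    have "- b + d \<in> cball (- b) a" using d(1) by (simp add: dist_norm)
    then obtain p' u where u: "- b + d = p' - A u" "p' \<in> polar_cone Q2" "u \<in> closed_hull Kinit"
      using sub by blast
    have p': "p' = A u - b + d" using u(1) by (simp add: algebra_simps)
    have "norm p' \<le> norm (A u) + norm b + norm d"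
      unfolding p' using norm_triangle_ineq[of "A u - b" d] norm_triangle_ineq4[of "A u" b] by linarith
    also have "\<dots> \<le> R * kA + norm b + a"
      using kA(1)[of u] mult_right_mono[OF hR[OF u(3)] kA(2)] d(1) by linarith
    finally have "M1 * norm p' \<le> M1 * (R * kA + norm b + a)" using M1(2) by (rule mult_left_mono)
    then have 1: "p \<bullet> p' \<le> M1 * (R * kA + norm b + a)" using M1(1) p u(2) by fastforce
    have "f u \<le> f 0 + gradf 0 \<bullet> u + \<beta> * (norm u)\<^sup>2" using quadratic_upper[of 0 u] by simp
    also have "\<dots> \<le> F"
      unfolding F_def using norm_cauchy_schwarz[of "gradf 0" u] mult_left_mono[OF hR[OF u(3)], of "norm (gradf 0)"]
        f_smooth(1) power_mono[OF hR[OF u(3)] norm_ge_zero, of 2]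
      by (intro add_mono mult_left_mono) auto
    finally have 2: "f u \<le> F" .
    have "- f u - p \<bullet> (A u - b) \<le> M" using cut_ge[of u p A b y] M u(3) by force
    moreover have "p \<bullet> p' = p \<bullet> (A u - b) + a * norm p" unfolding p' inner_add_right d(2) ..
    ultimately show ?thesis using 1 2 by (simp add: c_def)
  qed
  then show ?thesis using a by blast
qed

end

section \<open>Convergence rate\<close>

context dls_run
begin

interpretation A: bounded_linear A by (fact A)

text \<open>\<open>phase_counting\<close> requires a bound uniform in \<open>p\<close> and
  \<open>T\<close>; therefore the radii \<open>R\<close>, \<open>Rq\<close> and \<open>G\<close> are
  fixed for the whole run first.\<close>

lemma phase_sum_bound:
  "\<exists>B. \<forall>p T. p \<le> T \<longrightarrow> thr p = D p \<longrightarrow> (\<forall>t. p \<le> t \<longrightarrow> t < T \<longrightarrow> \<not> D (Suc t) < (1 - lam) * thr t)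
    \<longrightarrow> (\<Sum>t=p..T. (D t)\<^sup>2) \<le> B"
proof -
  obtain R where Ks_R: "\<And>t. Ks t \<subseteq> cball 0 R" and v_R: "\<And>t. norm (v t) \<le> R" and w0_R: "norm (w 0) \<le> R"
    using Ks_bounded_by by blast
  have w_R: "norm (w t) \<le> R" for t
  proof (induction t)
    case (Suc t)
    interpret C: dual_candidate f gradf \<beta> A b Q "w t" "q t" "l t" "Ks t" "\<nu> t"
      "neg_moment (\<nu> t)" "neg_mass (Ks t) (\<nu> t)" "w (Suc t)" "q (Suc t)"
      by (rule dual_candidate_step)
    show ?case using Suc Ks_R[of t] by (intro C.norm_next_le) auto
  qed (fact w0_R)
  have hull_R: "norm u \<le> R" if "u \<in> closed_hull (Ks t)" for u t
    using closed_hull_minimal[OF Ks_R[of t] closed_cball convex_cball] that by (auto simp: subset_iff)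
  obtain a c where a: "a > 0"
    and slater: "\<And>y p M. p \<in> Q \<Longrightarrow> (\<And>u. u \<in> closed_hull Kinit \<Longrightarrow> acut y p u \<le> M) \<Longrightarrow> a * norm p \<le> M + c"
    using slater_bound by metis
  \<comment> \<open>\<open>q 0\<close> need not lie on any level set and is included by the maximum.
    The \<open>+ 1\<close> leaves room for a comparison point feasible only up to
    \<open>\<epsilon> \<le> 1\<close>.\<close>
  define Rq where "Rq = max (norm (q 0)) ((hb 0 + 1 + c) / a)"
  have Rq: "norm p \<le> Rq" if pQ: "p \<in> Q" and cut: "\<And>u. u \<in> Ks t \<Longrightarrow> acut y p u \<le> hb 0 + 1" for y p t
  proof -
    have "acut y p u \<le> hb 0 + 1" if "u \<in> closed_hull Kinit" for u
      by (rule cut_le_on_hull[OF _ that]) (use cut Kinit_subset_Ks[of t] in blast)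
    then have "a * norm p \<le> hb 0 + 1 + c" by (rule slater[OF pQ])
    then have "norm p \<le> (hb 0 + 1 + c) / a" using a by (simp add: field_simps)
    then show ?thesis by (simp add: Rq_def)
  qed
  have q_R: "norm (q t) \<le> Rq" for t
  proof (cases t)
    case (Suc s)
    interpret C: dual_candidate f gradf \<beta> A b Q "w s" "q s" "l s" "Ks s" "\<nu> s"
      "neg_moment (\<nu> s)" "neg_mass (Ks s) (\<nu> s)" "w (Suc s)" "q (Suc s)"
      by (rule dual_candidate_step)
    have "acut (w (Suc s)) (q (Suc s)) u \<le> hb 0 + 1" if "u \<in> Ks s" for u
      using C.cut_le_level[OF that] l_le_hb0[of s] by simp
    then show ?thesis unfolding Suc using q_in_Q Rq by blast
  qed (simp add: Rq_def)
  define G where "G = norm b + Coracle"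
  have G: "norm (b - A (- v t)) \<le> G" for t
    using norm_triangle_ineq[of b "A (v t)"] norm_snd_le[of "A (v t)" "v t"] oracle_bound[of t]
    by (simp add: G_def A.neg)
  define C1 where "C1 = 32 * \<beta> * R\<^sup>2 + 4 * G\<^sup>2"
  have C1: "0 \<le> C1" using f_smooth(1) by (simp add: C1_def)
  define R0 where "R0 = \<beta> * (2 * R)\<^sup>2 + (2 * Rq)\<^sup>2 / 2"
  define \<delta> where "\<delta> t = bregman (w (Suc t)) (w t) + (norm (q (Suc t) - q t))\<^sup>2 / 2" for t
  have "(\<Sum>t=p..T. (D t)\<^sup>2) \<le> (D 0)\<^sup>2 + C1 * R0 / (1 - lam)\<^sup>2"
    if pT: "p \<le> T" and thr_p: "thr p = D p"
      and np: "\<And>t. p \<le> t \<Longrightarrow> t < T \<Longrightarrow> \<not> D (Suc t) < (1 - lam) * thr t" for p T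
  proof -
    have thr: "thr t = D p" if "p \<le> t" "t \<le> T" for t
      using that
    proof (induction t rule: dec_induct)
      case (step t) then show ?case using np[of t] by simp
    qed (simp add: thr_p)
    have Ks_mono: "Ks s \<subseteq> Ks t" if "p \<le> s" "s \<le> t" "t \<le> T" for s t
      using that(2,3)
    proof (induction t rule: dec_induct)
      case (step t) then show ?case using Ks_Suc[OF np[of t]] that(1) by auto
    qed simp
    \<comment> \<open>Fails for \<open>t = p\<close>, where pruning may discard \<open>- v p\<close>; that step is accounted for by \<open>(D 0)\<^sup>2\<close>.\<close>
    have v_Ks: "- v t \<in> Ks t" if "p < t" "t \<le> T" for t
      using that Ks_Suc[OF np[of "t - 1"]] by (cases t) auto
    \<comment> \<open>Without a restart up to \<open>T\<close>, \<open>D T\<close> is at least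
      \<open>(1 - lam) * D p\<close>, hence at least \<open>(1 - lam) * D t\<close>; with
      \<open>hb T \<le> hb t\<close>, the minimum of the last model is below every earlier
      level.\<close>
    have lT: "hl T \<le> l t" if t: "p < t" "t \<le> T" for t
    proof -
      obtain T' where T': "T = Suc T'" "p \<le> T'" using t by (cases T) auto
      have "(1 - lam) * D p \<le> D T" using np[of T'] thr[of T'] T' by simp
      moreover have "(1 - lam) * D t \<le> (1 - lam) * D p"
        using lam D_antimono[of p t] that by (intro mult_left_mono) auto
      moreover have "hb T \<le> hb t" using that by (intro hb_antimono)
      ultimately show ?thesis unfolding l_eq by (simp add: D_def)
    qed
    \<comment> \<open>The cut at \<open>- v t\<close> is at least \<open>hb t\<close> at the current
      point and at most \<open>l t\<close> at the next.\<close>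
    have descent: "((1 - lam) * D t)\<^sup>2 \<le> C1 * \<delta> t" if "p < t" "t \<le> T" for t
    proof -
      interpret C: dual_candidate f gradf \<beta> A b Q "w t" "q t" "l t" "Ks t" "\<nu> t"
        "neg_moment (\<nu> t)" "neg_mass (Ks t) (\<nu> t)" "w (Suc t)" "q (Suc t)"
        by (rule dual_candidate_step)
      have "(1 - lam) * D t \<le> acut (w t) (q t) (- v t) - acut (w (Suc t)) (q (Suc t)) (- v t)"
        using C.cut_le_level[OF v_Ks[OF that]] hb_le_hv[of t] unfolding l_eq hv_def by linarith
      moreover have "0 \<le> (1 - lam) * D t" using lam D_nonneg by simp
      ultimately show ?thesis
        unfolding C1_def \<delta>_def using w_R v_R G by (intro cut_decrease) auto
    qed
    \<comment> \<open>No bound on this total multiplier mass is at hand, but it is fixed once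
      \<open>p\<close> and \<open>T\<close> are, so \<open>\<epsilon>\<close> can be chosen
      afterwards with \<open>\<epsilon> * N \<le> \<eta>\<close>.\<close>
    define N where "N = (\<Sum>t=Suc p..<Suc T. - neg_mass (Ks t) (\<nu> t))"
    have N: "0 \<le> N" unfolding N_def by (intro sum_nonneg) (simp add: neg_mass_def)
    have "(\<Sum>t=Suc p..<Suc T. \<delta> t) \<le> R0 + \<eta>" if \<eta>: "0 < \<eta>" for \<eta>
    proof -
      define \<epsilon> where "\<epsilon> = min 1 (\<eta> / (N + 1))"
      have e: "0 < \<epsilon>" "\<epsilon> \<le> 1" using \<eta> N by (auto simp: \<epsilon>_def)
      have "\<epsilon> * N \<le> \<eta> / (N + 1) * (N + 1)"
        using N e \<eta> by (intro mult_mono) (auto simp: \<epsilon>_def)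
      then have eN: "\<epsilon> * N \<le> \<eta>" using N by simp
      have "bounded (closed_hull (Ks T))" using hull_R by (auto simp: bounded_iff)
      moreover have "closed_hull (Ks T) \<noteq> {}" using xhat_in_hull by blast
      moreover have "- hl T \<le> f u + r"
        if "u \<in> closed_hull (Ks T)" "\<And>p. p \<in> Q \<Longrightarrow> p \<bullet> (A u - b) \<le> r" for u r
        using that hull_Ks_subset_Kt by (intro hl_minimal) blast+
      \<comment> \<open>At the dual point \<open>(gradf ws, qs)\<close> all cuts of the last model
        are at most \<open>hl T + \<epsilon>\<close>.\<close>
      ultimately obtain ws qs where ws: "ws \<in> closed_hull (Ks T)" and qs: "qs \<in> Q"
        and dual: "\<And>x. x \<in> closed_hull (Ks T) \<Longrightarrow>
          - hl T - \<epsilon> \<le> f ws + gradf ws \<bullet> (x - ws) + qs \<bullet> (A x - b)"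
        using approximate_strong_duality[OF A Q_closed_convex Q_ne closed_closed_hull convex_closed_hull, of "Ks T" b "- hl T" \<epsilon>] e(1)
        by metis
      have cut: "acut ws qs x \<le> hl T + \<epsilon>" if "x \<in> Ks T" for x
        using dual[of x] that subset_closed_hull[of "Ks T"] by (auto simp: cut_def inner_simps)
      have "acut ws qs x \<le> hb 0 + 1" if "x \<in> Ks T" for x
        using cut[OF that] hl_le_hb[of T 0] e(2) by simp
      then have qs_R: "norm qs \<le> Rq" using Rq qs by blast
      \<comment> \<open>Distance from the comparison point to the iterate; its decrease telescopes
        over the phase.\<close>
      define \<Psi> where "\<Psi> t = bregman ws (w t) + (norm (qs - q t))\<^sup>2 / 2" for t
      have \<Psi>_nonneg: "0 \<le> \<Psi> t" for t using bregman_nonneg by (simp add: \<Psi>_def)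
      have \<Psi>_le: "\<Psi> t \<le> R0" for t
      proof -
        have "norm (w t - ws) \<le> 2 * R"
          using norm_triangle_ineq4[of "w t" ws] w_R[of t] hull_R[OF ws] by simp
        then have "bregman ws (w t) \<le> \<beta> * (2 * R)\<^sup>2"
          using bregman_upper[of ws "w t"] f_smooth(1)
          by (meson mult_left_mono norm_ge_zero order_trans power_mono less_imp_le)
        moreover have "norm (qs - q t) \<le> 2 * Rq"
          using norm_triangle_ineq4[of qs "q t"] q_R[of t] qs_R by simp
        then have "(norm (qs - q t))\<^sup>2 \<le> (2 * Rq)\<^sup>2" by (intro power_mono) auto
        ultimately show ?thesis by (simp add: \<Psi>_def R0_def)
      qed
      have "\<delta> t \<le> - (\<Psi> (Suc t) - \<Psi> t) + \<epsilon> * - neg_mass (Ks t) (\<nu> t)" if "p < t" "t \<le> T" for t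
      proof -
        interpret C: dual_candidate f gradf \<beta> A b Q "w t" "q t" "l t" "Ks t" "\<nu> t"
          "neg_moment (\<nu> t)" "neg_mass (Ks t) (\<nu> t)" "w (Suc t)" "q (Suc t)"
          by (rule dual_candidate_step)
        have "acut ws qs u \<le> l t + \<epsilon>" if "u \<in> Ks t" for u
          using cut[of u] Ks_mono[of t T] lT[of t] that \<open>p < t\<close> \<open>t \<le> T\<close> by fastforce
        from C.bregman_projection[OF qs this] show ?thesis
          unfolding \<delta>_def \<Psi>_def by linarith
      qed
      then have "(\<Sum>t=Suc p..<Suc T. \<delta> t)
          \<le> (\<Sum>t=Suc p..<Suc T. - (\<Psi> (Suc t) - \<Psi> t) + \<epsilon> * - neg_mass (Ks t) (\<nu> t))"
        by (intro sum_mono) auto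
      also have "\<dots> = - (\<Sum>t=Suc p..<Suc T. \<Psi> (Suc t) - \<Psi> t) + \<epsilon> * N"
        by (simp only: N_def sum.distrib sum_distrib_left) (simp only: sum_negf)
      also have "\<dots> = \<Psi> (Suc p) - \<Psi> (Suc T) + \<epsilon> * N"
        using pT by (subst sum_Suc_diff') auto
      also have "\<dots> \<le> R0 + \<eta>" using \<Psi>_le[of "Suc p"] \<Psi>_nonneg[of "Suc T"] eN by linarith
      finally show ?thesis .
    qed
    then have "(\<Sum>t=Suc p..<Suc T. \<delta> t) \<le> R0" by (rule field_le_epsilon)
    then have "C1 * (\<Sum>t=Suc p..<Suc T. \<delta> t) \<le> C1 * R0" using C1 by (rule mult_left_mono)
    moreover have "(\<Sum>t=Suc p..<Suc T. ((1 - lam) * D t)\<^sup>2) \<le> (\<Sum>t=Suc p..<Suc T. C1 * \<delta> t)"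
      using descent by (intro sum_mono) auto
    ultimately have "(1 - lam)\<^sup>2 * (\<Sum>t=Suc p..<Suc T. (D t)\<^sup>2) \<le> C1 * R0"
      by (simp add: sum_distrib_left power_mult_distrib del: sum.op_ivl_Suc)
    then have "(\<Sum>t=Suc p..<Suc T. (D t)\<^sup>2) \<le> C1 * R0 / (1 - lam)\<^sup>2"
      using lam by (simp add: field_simps del: sum.op_ivl_Suc)
    moreover have "(D p)\<^sup>2 \<le> (D 0)\<^sup>2" using D_antimono[of 0 p] D_nonneg by (intro power_mono) auto
    moreover have "(\<Sum>t=p..T. (D t)\<^sup>2) = (D p)\<^sup>2 + (\<Sum>t=Suc p..<Suc T. (D t)\<^sup>2)"
      using pT by (simp add: atLeastLessThanSuc_atLeastAtMost sum.atLeast_Suc_atMost del: sum.op_ivl_Suc)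
    ultimately show ?thesis by linarith
  qed
  then show ?thesis by blast
qed

lemma D_le_thr: "D t \<le> thr t"
proof (induction t)
  case (Suc t) then show ?case using D_antimono[of t "Suc t"] by auto
qed simp

lemma gap_rate: "\<exists>C>0. \<forall>t\<ge>1. D t \<le> C / sqrt (real t)"
proof -
  obtain B where B: "\<And>p T. p \<le> T \<Longrightarrow> thr p = D p \<Longrightarrow>
      (\<And>t. p \<le> t \<Longrightarrow> t < T \<Longrightarrow> \<not> D (Suc t) < (1 - lam) * thr t) \<Longrightarrow> (\<Sum>t=p..T. (D t)\<^sup>2) \<le> B"
    using phase_sum_bound by blast
  define C where "C = B / ((1 - lam)\<^sup>2 * (1 - (1 - lam)\<^sup>2))"
  have C: "real (t + 1) * (thr t)\<^sup>2 \<le> C" for t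
    unfolding C_def using lam D_nonneg B by (intro phase_counting) auto
  \<comment> \<open>The \<open>+ 1\<close> keeps the constant positive even if
    \<open>C = 0\<close>.\<close>
  have "D t \<le> (sqrt C + 1) / sqrt (real t)" if "t \<ge> 1" for t
  proof -
    have "real t * (D t)\<^sup>2 \<le> real (t + 1) * (thr t)\<^sup>2"
      using D_le_thr[of t] D_nonneg[of t] by (intro mult_mono power_mono) auto
    then have "sqrt (real t * (D t)\<^sup>2) \<le> sqrt C" using C[of t] by (intro real_sqrt_le_mono) linarith
    then have "sqrt (real t) * D t \<le> sqrt C + 1" using D_nonneg[of t] by (simp add: real_sqrt_mult)
    then show ?thesis using that by (simp add: field_simps)
  qed
  moreover have "0 \<le> C" using C[of 0] order_trans[of 0 "real (0 + 1) * (thr 0)\<^sup>2" C] by simp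
  then have "0 < sqrt C + 1" using real_sqrt_ge_zero[of C] by linarith
  ultimately show ?thesis by blast
qed

text \<open>Admissibility of \<open>x1 t\<close> bounds \<open>V\<close> above and the cut at the
  best dual iterate bounds it below. Hence \<open>V\<close> is finite and both errors are at most
  \<open>D t\<close>.\<close>

lemma value_bounds:
  assumes "V = (INF x. ereal (f x) + support_fun Q (A x - b) + indicator_fun K x)"
  obtains r where "V = ereal r" "\<And>t. r \<le> - hl t" "\<And>t. - hb t \<le> r"
proof -
  have le: "V \<le> ereal (- hl t)" for t
    unfolding assms
    by (rule INF_lower2[of "x1 t"]) (simp_all add: support_xhat indicator_fun_def xhat_in_K)
  have ge: "ereal (- hb t) \<le> V" for t
    unfolding assms
  proof (rule INF_greatest)
    fix x
    obtain s where s: "hb t = hv s" using muhat_eq by blast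
    show "ereal (- hb t) \<le> ereal (f x) + support_fun Q (A x - b) + indicator_fun K x"
    proof (cases "x \<in> K")
      case True
      have "- hb t \<le> f x + q s \<bullet> (A x - b)"
        using cut_le_hv[OF True, of s] cut_ge[of x "q s" A b "w s"] s by linarith
      then have "ereal (- hb t) \<le> ereal (f x) + ereal (q s \<bullet> (A x - b))" by simp
      also have "\<dots> \<le> ereal (f x) + support_fun Q (A x - b)"
        by (intro add_left_mono support_fun_ge q_in_Q)
      finally show ?thesis using True by (simp add: indicator_fun_def)
    qed (simp add: indicator_fun_def)
  qed
  obtain r where r: "V = ereal r" using le[of 0] ge[of 0] by (cases V) auto
  show ?thesis using that[OF r] le ge by (simp add: r)
qed

text \<open>The supremum over \<open>E\<close> is attained at \<open>(v s, A (v s))\<close> by the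
  choice of the oracle, and the conjugate at \<open>gradf (w s)\<close> is given by equality in
  Fenchel-Young.\<close>

lemma dual_value:
  assumes E: "E = {x. fst x \<in> uminus ` K \<and> snd x = A (fst x)}"
  shows "conjugate f (fst (\<mu>hat t)) + indicator_fun Q (snd (\<mu>hat t))
        + ereal (snd (\<mu>hat t) \<bullet> b) + support_fun E (\<mu>hat t) = ereal (hb t)"
proof -
  obtain s where s: "\<mu>hat t = \<mu> s" "hb t = hv s" using muhat_eq by blast
  have "support_fun E (\<mu> s) = ereal (fst (\<mu> s) \<bullet> v s + q s \<bullet> A (v s))"
  proof (rule antisym)
    show "support_fun E (\<mu> s) \<le> ereal (fst (\<mu> s) \<bullet> v s + q s \<bullet> A (v s))"
      unfolding support_fun_def
    proof (rule SUP_least)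
      fix x assume "x \<in> E"
      then obtain u where u: "u \<in> K" "x = (- u, A (- u))" by (cases x) (auto simp: E)
      then show "ereal (\<mu> s \<bullet> x) \<le> ereal (fst (\<mu> s) \<bullet> v s + q s \<bullet> A (v s))"
        using cut_le_hv[OF u(1), of s]
        by (simp add: inner_prod_def hv_def cut_def fst_mu inner_simps A.neg)
    qed
    have "(v s, A (v s)) \<in> E" using neg_v_in_K[of s] by (auto simp: E image_iff intro!: bexI[of _ "- v s"])
    then show "ereal (fst (\<mu> s) \<bullet> v s + q s \<bullet> A (v s)) \<le> support_fun E (\<mu> s)"
      unfolding support_fun_def by (rule SUP_upper2) (simp add: inner_prod_def)
  qed
  then show ?thesis
    using q_in_Q[of s]
    by (simp add: s indicator_fun_def fst_mu conjugate_gradient hv_def cut_def inner_simps A.neg)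
qed

end

theorem theorem4p15:
  fixes f :: "'a::{real_inner,complete_space} \<Rightarrow> real"
    and gradf :: "'a \<Rightarrow> 'a"
    and A :: "'a \<Rightarrow> 'b::{real_inner,complete_space}"
    and b :: 'b
    and Q Q1 Q2 :: "'b set"
    and K Kinit :: "'a set"
    and \<beta> lam Coracle :: real
    and V :: ereal
    and E :: "('a \<times> 'b) set"
    and \<mu>0 :: "'a \<times> 'b"
    and \<mu> \<mu>hat xhat :: "nat \<Rightarrow> 'a \<times> 'b"
    and w v :: "nat \<Rightarrow> 'a"
    and hbar hlow \<Delta> lev Dbar :: "nat \<Rightarrow> ereal"
    and Ks :: "nat \<Rightarrow> 'a set"
    and \<nu> :: "nat \<Rightarrow> 'a measure"
  assumes f_convex: "convex_on UNIV f"
    and f_grad: "\<And>x. GDERIV f x :> gradf x"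
    and f_smooth: "\<beta> > 0" "\<beta>-lipschitz_on UNIV gradf"
    and Q: "Q \<noteq> {}" "Q = {q1 + q2 | q1 q2. q1 \<in> Q1 \<and> q2 \<in> Q2}"
    and Q1: "closed Q1" "convex Q1" "bounded Q1"
    and Q2: "closed Q2" "convex Q2" "cone Q2"
    and K: "K \<noteq> {}" "closed K" "convex K"
    and A: "bounded_linear A"
    and \<mu>0: "\<mu>0 \<in> dom_subdiff (conjugate f) \<times> Q"
      "fst \<mu>0 + adjoint A (snd \<mu>0) \<in> eff_dom (support_fun (uminus ` K))"
    and Kinit: "compact Kinit" "Kinit \<subseteq> K"
      "- b \<in> interior {p - A x | p x. p \<in> polar_cone Q2 \<and> x \<in> closed_hull Kinit}"
    and V: "V = (INF x. ereal (f x) + support_fun Q (A x - b) + indicator_fun K x)"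
    and E: "E = {x. fst x \<in> uminus ` K \<and> snd x = A (fst x)}"
    and lam: "0 < lam" "lam < 1"
    and dls: "dls_method f gradf A b Q K Kinit \<mu>0 lam
                \<mu> w v hbar \<mu>hat xhat hlow \<Delta> lev Dbar Ks \<nu>"
    and subdiff_E: "\<And>t. subdiff (support_fun E) (\<mu> t) \<noteq> {}"
    and oracle_bound: "\<And>t. norm (v t, A (v t)) \<le> Coracle"
  shows "\<Delta> \<longlonglongrightarrow> 0 \<and>
    (\<exists>C>0. \<forall>t\<ge>1. \<Delta> t \<le> ereal (C / sqrt (real t))) \<and>
    (\<forall>t. snd (xhat t) = A (fst (xhat t))) \<and>
    (\<exists>C>0. \<forall>t\<ge>1. ereal (f (fst (xhat t))) + support_fun Q (A (fst (xhat t)) - b) - V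
        \<le> ereal (C / sqrt (real t))) \<and>
    (\<exists>C>0. \<forall>t\<ge>1. conjugate f (fst (\<mu>hat t)) + indicator_fun Q (snd (\<mu>hat t))
        + ereal (snd (\<mu>hat t) \<bullet> b) + support_fun E (\<mu>hat t) + V
        \<le> ereal (C / sqrt (real t)))"
proof -
  have "snd \<mu>0 \<in> Q" using \<mu>0(1) by auto
  interpret dls_run f gradf \<beta> A b Q Q1 Q2 K Kinit lam Coracle \<mu>0
      \<mu> \<mu>hat xhat w v hbar hlow \<Delta> lev Dbar Ks \<nu>
    by (intro dls_run.intro smooth_convex.intro dls_run_axioms.intro) fact+
  obtain C where C: "C > 0" "\<And>t. t \<ge> 1 \<Longrightarrow> D t \<le> C / sqrt (real t)" using gap_rate by blast
  obtain r where r: "V = ereal r" "\<And>t. r \<le> - hl t" "\<And>t. - hb t \<le> r" using value_bounds[OF V] by blast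
  have "D \<longlonglongrightarrow> 0"
  proof (rule tendsto_sandwich)
    show "\<forall>\<^sub>F t in sequentially. 0 \<le> D t" using D_nonneg by simp
    show "\<forall>\<^sub>F t in sequentially. D t \<le> C / sqrt (real t)"
      using C(2) by (rule eventually_sequentiallyI)
    show "(\<lambda>t. C / sqrt (real t)) \<longlonglongrightarrow> 0"
      by (intro tendsto_divide_0[OF tendsto_const] filterlim_at_top_imp_at_infinity
          filterlim_compose[OF sqrt_at_top filterlim_real_sequentially])
  qed (rule tendsto_const)
  then have "(\<lambda>t. ereal (D t)) \<longlonglongrightarrow> ereal 0" by (rule tendsto_ereal)
  then have lim: "\<Delta> \<longlonglongrightarrow> 0"
    unfolding gap_eq[symmetric] zero_ereal_def[symmetric] .
  have gap: "\<Delta> t \<le> ereal (C / sqrt (real t))" if "t \<ge> 1" for t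
    using C(2)[OF that] by (simp add: gap_eq)
  \<comment> \<open>The primal error uses \<open>- hb t \<le> r\<close>, the dual error below uses
    \<open>r \<le> - hl t\<close>.\<close>
  have primal: "ereal (f (fst (xhat t))) + support_fun Q (A (fst (xhat t)) - b) - V \<le> ereal (C / sqrt (real t))"
    if "t \<ge> 1" for t
    using C(2)[OF that] r(3)[of t] by (simp add: support_xhat r(1) D_def)
  have dual: "conjugate f (fst (\<mu>hat t)) + indicator_fun Q (snd (\<mu>hat t))
        + ereal (snd (\<mu>hat t) \<bullet> b) + support_fun E (\<mu>hat t) + V \<le> ereal (C / sqrt (real t))"
    if "t \<ge> 1" for t
    unfolding dual_value[OF E] using C(2)[OF that] r(2)[of t] by (simp add: r(1) D_def)
  show ?thesis using lim gap primal dual snd_xhat C(1) by blast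
qed

end
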